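(* Let $G$ be any compact group, let $d(G)$ be its commutativity degree and let $F$ be its FC-center. Then: (i) The following conditions are equivalent: (1) $d(G)>0$; (2) the center $Z(F)$ of $F$ is open in $G$. (ii) If the equivalent conditions of (i) are satisfied, then there is a finite set of elements $g_1,\dots,g_n\in G$, $n\le |G/Z(F,G)|$, such that $$d(G)=\frac{1}{|G/F|\cdot|G/Z(F,G)|}\cdot\sum_{j=1}^n |F/Z(g_j,F)|^{-1}.$$ (iii) $d(G)$ is always a rational number.
   Context: Compact groups are Hausdorff topological groups. Let $\nu$ be the normalized Haar measure on $G$. The commutativity degree of $G$ is $d(G)=(\nu\times\nu)(\{(x,y)\in G\times G : [x,y]=1\})$, where $\nu\times\nu$ is the product measure on $G\times G$, i.e. the normalized Haar measure of the compact group $G\times G$, and $[x,y]$ is the commutator. The FC-center $F$ of $G$ is the subgroup of all elements of $G$ whose conjugacy class in $G$ is finite. $Z(F,G)=\{g\in G : gx=xg \text{ for all } x\in F\}$ is the centralizer of $F$ in $G$, and for $g\in G$, $Z(g,F)=\{x\in F : xg=gx\}$. For a subgroup $B$ of a group $A$, $|A/B|$ denotes the index of $B$ in $A$. *)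

theory Defs
  imports "HOL-Analysis.Analysis" "HOL-Algebra.Coset"
begin

locale topological_group = group G for G (structure) +
  fixes T :: "'a topology"
  assumes topspace_eq_carrier: "topspace T = carrier G"
    and continuous_mult: "continuous_map (prod_topology T T) T (\<lambda>(x, y). x \<otimes> y)"
    and continuous_inv: "continuous_map T T (\<lambda>x. inv x)"

locale compact_group = topological_group +
  assumes compact: "compact_space T"
    and hausdorff: "Hausdorff_space T"

definition borel_of :: "'a topology \<Rightarrow> 'a measure" where
  "borel_of T = sigma (topspace T) {U. openin T U}"

text \<open>
  \<open>M\<close> is the normalized Haar measure of the compact group \<open>G\<close> with topology \<open>T\<close>: the
  left-invariant regular Borel probability measure.
\<close>

definition normalized_haar_measure ::
    "('a, 'b) monoid_scheme \<Rightarrow> 'a topology \<Rightarrow> 'a measure \<Rightarrow> bool" where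
  "normalized_haar_measure G T M \<longleftrightarrow>
     sets M = sets (borel_of T) \<and>
     emeasure M (space M) = 1 \<and>
     (\<forall>g\<in>carrier G. \<forall>A\<in>sets M. emeasure M (g <#\<^bsub>G\<^esub> A) = emeasure M A) \<and>
     (\<forall>A\<in>sets M. emeasure M A = (INF U\<in>{U. openin T U \<and> A \<subseteq> U}. emeasure M U)) \<and>
     (\<forall>U. openin T U \<longrightarrow>
        emeasure M U = (SUP K\<in>{K. compactin T K \<and> K \<subseteq> U}. emeasure M K))"

text \<open>
  Here \<open>P\<close> stands for the normalized Haar measure of the compact group \<open>G \<times>\<times> G\<close>, i.e. for
  \<open>\<nu> \<times> \<nu>\<close> as a measure on the Borel sets of the product topology. When \<open>G\<close> is not second
  countable, the measure \<open>\<nu> \<Otimes>\<^sub>M \<nu>\<close> of the library will not do: its sigma-algebra may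
  be strictly smaller and need not contain the closed set of commuting pairs.
\<close>

definition commutativity_degree ::
    "('a, 'b) monoid_scheme \<Rightarrow> ('a \<times> 'a) measure \<Rightarrow> real" where
  "commutativity_degree G P = measure P
     {(x, y) \<in> carrier G \<times> carrier G.
        inv\<^bsub>G\<^esub> x \<otimes>\<^bsub>G\<^esub> inv\<^bsub>G\<^esub> y \<otimes>\<^bsub>G\<^esub> x \<otimes>\<^bsub>G\<^esub> y = \<one>\<^bsub>G\<^esub>}"

definition conjugacy_class :: "('a, 'b) monoid_scheme \<Rightarrow> 'a \<Rightarrow> 'a set" where
  "conjugacy_class G x = {inv\<^bsub>G\<^esub> g \<otimes>\<^bsub>G\<^esub> x \<otimes>\<^bsub>G\<^esub> g | g. g \<in> carrier G}"

definition FC_center :: "('a, 'b) monoid_scheme \<Rightarrow> 'a set" where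
  "FC_center G = {x \<in> carrier G. finite (conjugacy_class G x)}"

text \<open>
  With \<open>F = FC_center G\<close>, \<open>centralizer G F (carrier G)\<close> is \<open>Z(F, G)\<close>,
  \<open>centralizer G {g} F\<close> is \<open>Z(g, F)\<close>, and \<open>centralizer G F F\<close> is the center \<open>Z(F)\<close>.
\<close>

definition centralizer :: "('a, 'b) monoid_scheme \<Rightarrow> 'a set \<Rightarrow> 'a set \<Rightarrow> 'a set" where
  "centralizer G A B = {b \<in> B. \<forall>a\<in>A. b \<otimes>\<^bsub>G\<^esub> a = a \<otimes>\<^bsub>G\<^esub> b}"

text \<open>
  The index \<open>|A/B|\<close> for subgroups \<open>B \<subseteq> A\<close> of \<open>G\<close>. Since \<open>card\<close> is \<open>0\<close> on infinite sets,
  \<open>subgroup_index\<close> is the true index only under \<open>finite_index\<close>.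
\<close>

definition finite_index :: "('a, 'b) monoid_scheme \<Rightarrow> 'a set \<Rightarrow> 'a set \<Rightarrow> bool" where
  "finite_index G A B \<longleftrightarrow> finite (rcosets\<^bsub>G\<lparr>carrier := A\<rparr>\<^esub> B)"

definition subgroup_index :: "('a, 'b) monoid_scheme \<Rightarrow> 'a set \<Rightarrow> 'a set \<Rightarrow> nat" where
  "subgroup_index G A B = card (rcosets\<^bsub>G\<lparr>carrier := A\<rparr>\<^esub> B)"

end

theory Submission
  imports Defs
begin

text \<open>Elements with more than \<open>n\<close> conjugates contribute at most \<open>1/(n+1)\<close> to \<open>d(G)\<close>, because
  centralizers of index greater than \<open>n\<close> have \<open>n + 1\<close> disjoint cosets. So if \<open>d(G) > 0\<close>, the set of
  elements with at most \<open>n\<close> conjugates has positive measure for some \<open>n\<close>, and its difference set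
  is a neighbourhood of \<open>\<one>\<close> consisting of elements with at most \<open>n\<^sup>2\<close> conjugates. Then \<open>F\<close> is open, and
  Neumann's argument on groups with bounded conjugacy classes makes \<open>Z(F)\<close> open. Conversely \<open>Z(F) \<times> Z(F)\<close>
  consists of commuting pairs.

  If \<open>Z(F)\<close> is open, almost all commuting pairs lie in \<open>F \<times> G\<close>, and those in \<open>F \<times> gZ(F, G)\<close> form the
  set \<open>Z(g, F) \<times> gZ(F, G)\<close>. The formula sums the measures of these sets over the cosets \<open>gZ(F, G)\<close>;
  those with \<open>Z(g, F)\<close> of infinite index in \<open>F\<close> are null and drop out.\<close>

no_notation (ASCII) subset_mset (infix "<#" 50)

section \<open>Cosets and conjugacy classes\<close>

lemma (in group) mem_l_coset_iff:
  assumes "A \<subseteq> carrier G" "g \<in> carrier G"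
  shows "x \<in> g <# A \<longleftrightarrow> x \<in> carrier G \<and> inv g \<otimes> x \<in> A"
proof
  assume "x \<in> g <# A"
  then obtain a where "a \<in> A" "x = g \<otimes> a" by (auto simp: l_coset_def)
  with assms show "x \<in> carrier G \<and> inv g \<otimes> x \<in> A"
    by (auto simp: subset_iff simp flip: m_assoc)
next
  assume "x \<in> carrier G \<and> inv g \<otimes> x \<in> A"
  moreover from this have "x = g \<otimes> (inv g \<otimes> x)"
    using assms by (simp add: m_assoc [symmetric])
  ultimately show "x \<in> g <# A"
    by (auto simp: l_coset_def)
qed

lemma l_coset_DirProd: "(a, b) <#\<^bsub>G \<times>\<times> H\<^esub> (A \<times> B) = (a <#\<^bsub>G\<^esub> A) \<times> (b <#\<^bsub>H\<^esub> B)"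
  by (auto simp: l_coset_def)

text \<open>The index is defined through right cosets, while Haar measure is invariant under left
  translation. Inversion mediates: inverses of representatives of right cosets represent the left
  cosets. The equivalence for \<open>finite R\<close> also makes infinite index usable.\<close>

lemma (in group) left_transversal:
  assumes A: "subgroup A G" and B: "subgroup B G" and "B \<subseteq> A"
  obtains R where "R \<subseteq> A" "finite R \<longleftrightarrow> finite_index G A B" "card R = subgroup_index G A B"
    "disjoint_family_on (\<lambda>r. r <# B) R" "(\<Union>r\<in>R. r <# B) = A"
proof -
  define Q where "Q = (\<lambda>a. B #> a) ` A"
  have Q: "rcosets\<^bsub>G\<lparr>carrier := A\<rparr>\<^esub> B = Q"
    by (auto simp: RCOSETS_def Q_def)
  have "\<exists>a. a \<in> A \<and> C = B #> a" if "C \<in> Q" for C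
    using that by (auto simp: Q_def)
  then obtain rep where rep: "\<And>C. C \<in> Q \<Longrightarrow> rep C \<in> A \<and> C = B #> rep C"
    by metis
  have AG: "A \<subseteq> carrier G" and BG: "B \<subseteq> carrier G"
    using A B subgroup.subset by blast+
  define R where "R = (\<lambda>C. inv (rep C)) ` Q"
  have inj: "inj_on (\<lambda>C. inv (rep C)) Q"
    by (rule inj_onI) (metis AG inv_inv rep subset_iff)
  have RA: "R \<subseteq> A"
    using rep A by (auto simp: R_def subgroup.m_inv_closed)
  \<comment> \<open>The left coset containing \<open>x\<close> is read off from the right coset
    \<open>B #> inv x\<close>; disjointness and covering both follow from this.\<close>
  have mem: "x \<in> inv (rep C) <# B \<longleftrightarrow> x \<in> A \<and> B #> inv x = C" if C: "C \<in> Q" for x C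
  proof -
    have r: "rep C \<in> A" "rep C \<in> carrier G" and CB: "C = B #> rep C"
      using rep [OF C] AG by auto
    have "x \<in> A \<and> B #> inv x = C" if x: "x \<in> inv (rep C) <# B"
    proof -
      have xc: "x \<in> carrier G" and rx: "rep C \<otimes> x \<in> B"
        using x r BG by (auto simp: mem_l_coset_iff)
      obtain b where b: "b \<in> B" "x = inv (rep C) \<otimes> b"
        using x by (auto simp: l_coset_def)
      have "x \<in> A"
        using b r A \<open>B \<subseteq> A\<close> by (auto intro: subgroup.m_closed subgroup.m_inv_closed)
      moreover have "rep C \<in> B #> inv x"
        using rx r xc by (subst subgroup.rcos_module [OF B is_group]) auto
      then have "B #> inv x = B #> rep C"
        using repr_independence [OF _ _ B] xc by auto
      ultimately show ?thesis using CB by simp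
    qed
    moreover have "x \<in> inv (rep C) <# B" if x: "x \<in> A" "B #> inv x = C"
    proof -
      have xc: "x \<in> carrier G" using x AG by auto
      have "rep C \<in> B #> inv x"
        using x CB rcos_self [OF r(2) B] by auto
      then have "rep C \<otimes> x \<in> B"
        using r xc by (subst (asm) subgroup.rcos_module [OF B is_group]) auto
      then show ?thesis
        using r xc BG by (simp add: mem_l_coset_iff)
    qed
    ultimately show ?thesis by blast
  qed
  show thesis
  proof
    show "R \<subseteq> A" by (fact RA)
    show "finite R \<longleftrightarrow> finite_index G A B"
      unfolding finite_index_def Q R_def by (rule finite_image_iff [OF inj])
    show "card R = subgroup_index G A B"
      unfolding subgroup_index_def Q R_def by (rule card_image [OF inj])
    show "disjoint_family_on (\<lambda>r. r <# B) R"
      by (auto simp: disjoint_family_on_def R_def mem)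
    show "(\<Union>r\<in>R. r <# B) = A"
    proof (intro equalityI subsetI)
      fix x assume "x \<in> A"
      then have "B #> inv x \<in> Q"
        using A by (auto simp: Q_def subgroup.m_inv_closed)
      with \<open>x \<in> A\<close> show "x \<in> (\<Union>r\<in>R. r <# B)"
        by (auto simp: R_def mem)
    qed (auto simp: R_def mem)
  qed
qed

section \<open>Centralizers, conjugation and commutators\<close>

lemma (in group) subgroup_centralizer:
  assumes "S \<subseteq> carrier G" "subgroup A G"
  shows "subgroup (centralizer G S A) G"
proof (rule subgroupI)
  have AG: "A \<subseteq> carrier G" using assms(2) subgroup.subset by blast
  then show "centralizer G S A \<subseteq> carrier G"
    by (auto simp: centralizer_def)
  have "\<one> \<in> centralizer G S A"
    using assms by (auto simp: centralizer_def subgroup.one_closed subset_iff)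
  then show "centralizer G S A \<noteq> {}" by blast
  fix a assume a: "a \<in> centralizer G S A"
  then have aA: "a \<in> A" "a \<in> carrier G" using AG by (auto simp: centralizer_def)
  have "inv a \<otimes> s = s \<otimes> inv a" if s: "s \<in> S" for s
  proof -
    have sc: "s \<in> carrier G" using s assms by auto
    have "a \<otimes> s = s \<otimes> a" using a s by (auto simp: centralizer_def)
    then have "a \<otimes> (s \<otimes> inv a) = s"
      using aA sc by (simp add: inv_solve_right' flip: m_assoc)
    then show ?thesis
      using aA sc by (simp add: inv_solve_left')
  qed
  then show "inv a \<in> centralizer G S A"
    using aA assms(2) by (auto simp: centralizer_def subgroup.m_inv_closed)
  fix b assume b: "b \<in> centralizer G S A"
  then have bA: "b \<in> A" "b \<in> carrier G" using AG by (auto simp: centralizer_def)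
  have "(a \<otimes> b) \<otimes> s = s \<otimes> (a \<otimes> b)" if s: "s \<in> S" for s
  proof -
    have sc: "s \<in> carrier G" using s assms by auto
    have "a \<otimes> s = s \<otimes> a" "b \<otimes> s = s \<otimes> b" using a b s by (auto simp: centralizer_def)
    then show ?thesis
      using aA bA sc by (metis m_assoc)
  qed
  then show "a \<otimes> b \<in> centralizer G S A"
    using aA bA assms(2) by (auto simp: centralizer_def subgroup.m_closed)
qed

lemma (in group) conj_mult:
  assumes "x \<in> carrier G" "y \<in> carrier G" "g \<in> carrier G"
  shows "inv g \<otimes> (x \<otimes> y) \<otimes> g = (inv g \<otimes> x \<otimes> g) \<otimes> (inv g \<otimes> y \<otimes> g)"
proof -
  have "g \<otimes> (inv g \<otimes> (y \<otimes> g)) = y \<otimes> g"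
    using assms by (simp add: m_assoc [symmetric])
  then show ?thesis using assms by (simp add: m_assoc)
qed

lemma (in group) conj_eq_iff_commute:
  assumes "x \<in> carrier G" "g \<in> carrier G"
  shows "inv g \<otimes> x \<otimes> g = x \<longleftrightarrow> x \<otimes> g = g \<otimes> x"
  using assms by (simp add: m_assoc inv_solve_left')

lemma (in group) commutator_eq_one_iff:
  assumes "x \<in> carrier G" "y \<in> carrier G"
  shows "inv x \<otimes> inv y \<otimes> x \<otimes> y = \<one> \<longleftrightarrow> x \<otimes> y = y \<otimes> x"
proof -
  have "inv x \<otimes> inv y \<otimes> x \<otimes> y = inv (y \<otimes> x) \<otimes> (x \<otimes> y)"
    using assms by (simp add: inv_mult_group m_assoc)
  then show ?thesis
    using assms by (simp add: inv_solve_left')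
qed

text \<open>The FC-center is the increasing union of the levels \<open>FC_level G n\<close>. Unlike the FC-center
  itself, each of these is closed in a Hausdorff group.\<close>

definition FC_level :: "('a, 'b) monoid_scheme \<Rightarrow> nat \<Rightarrow> 'a set" where
  "FC_level G n = {x \<in> carrier G. finite (conjugacy_class G x) \<and> card (conjugacy_class G x) \<le> n}"

lemma FC_level_subset_FC_center: "FC_level G n \<subseteq> FC_center G"
  by (auto simp: FC_level_def FC_center_def)

lemma FC_center_subset: "FC_center G \<subseteq> carrier G"
  by (auto simp: FC_center_def)

lemma (in group) conjugacy_class_mult_subset:
  assumes "x \<in> carrier G" "y \<in> carrier G"
  shows "conjugacy_class G (x \<otimes> y)
    \<subseteq> (\<lambda>(a, b). a \<otimes> b) ` (conjugacy_class G x \<times> conjugacy_class G y)"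
  using assms by (force simp: conjugacy_class_def conj_mult)

lemma (in group) conjugacy_class_inv:
  assumes "x \<in> carrier G"
  shows "conjugacy_class G (inv x) = (\<lambda>a. inv a) ` conjugacy_class G x"
proof -
  have "inv g \<otimes> inv x \<otimes> g = inv (inv g \<otimes> x \<otimes> g)" if "g \<in> carrier G" for g
    using assms that by (simp add: inv_mult_group m_assoc)
  then show ?thesis
    by (auto simp: conjugacy_class_def image_def) metis+
qed

text \<open>A conjugate of a product is the product of the conjugates by the same element, so it is
  determined by a pair from the two classes.\<close>

lemma (in group) FC_level_mult:
  assumes "x \<in> FC_level G m" "y \<in> FC_level G n"
  shows "x \<otimes> y \<in> FC_level G (m * n)"
proof -
  let ?X = "conjugacy_class G x" and ?Y = "conjugacy_class G y"
  have x: "x \<in> carrier G" "finite ?X" "card ?X \<le> m" and y: "y \<in> carrier G" "finite ?Y" "card ?Y \<le> n"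
    using assms by (auto simp: FC_level_def)
  have sub: "conjugacy_class G (x \<otimes> y) \<subseteq> (\<lambda>(a, b). a \<otimes> b) ` (?X \<times> ?Y)"
    by (rule conjugacy_class_mult_subset) (use x y in auto)
  moreover have fin: "finite ((\<lambda>(a, b). a \<otimes> b) ` (?X \<times> ?Y))"
    using x y by auto
  moreover have "card ((\<lambda>(a, b). a \<otimes> b) ` (?X \<times> ?Y)) \<le> card (?X \<times> ?Y)"
    by (rule card_image_le) (use x y in auto)
  moreover have "card (?X \<times> ?Y) \<le> m * n"
    using x y by (simp add: card_cartesian_product mult_le_mono)
  ultimately show ?thesis
    using x y finite_subset [OF sub fin] card_mono [OF fin sub] by (auto simp: FC_level_def)
qed

lemma (in group) FC_level_inv:
  assumes "x \<in> FC_level G n"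
  shows "inv x \<in> FC_level G n"
  using assms card_image_le [of "conjugacy_class G x" "\<lambda>a. inv a"]
  by (auto simp: FC_level_def conjugacy_class_inv)

lemma (in group) subgroup_FC_center: "subgroup (FC_center G) G"
proof (rule subgroupI)
  have "conjugacy_class G \<one> \<subseteq> {\<one>}"
    by (auto simp: conjugacy_class_def)
  then have "finite (conjugacy_class G \<one>)"
    using finite_subset by blast
  then show "FC_center G \<noteq> {}"
    by (auto simp: FC_center_def)
  have level: "x \<in> FC_level G (card (conjugacy_class G x))" if "x \<in> FC_center G" for x
    using that by (auto simp: FC_center_def FC_level_def)
  show "inv x \<in> FC_center G" if "x \<in> FC_center G" for x
    by (rule subsetD [OF FC_level_subset_FC_center FC_level_inv [OF level [OF that]]])
  show "x \<otimes> y \<in> FC_center G" if "x \<in> FC_center G" "y \<in> FC_center G" for x y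
    by (rule subsetD [OF FC_level_subset_FC_center FC_level_mult [OF level level]]) (use that in auto)
qed (fact FC_center_subset)

text \<open>Orbit-stabilizer: sending the right coset of \<open>g\<close> to
  \<open>inv g \<otimes> x \<otimes> g\<close> is a bijection from the cosets of the centralizer
  onto the conjugacy class.\<close>

lemma (in group) finite_index_centralizer_iff:
  assumes x: "x \<in> carrier G"
  shows "finite_index G (carrier G) (centralizer G {x} (carrier G)) \<longleftrightarrow> finite (conjugacy_class G x)"
proof -
  let ?C = "centralizer G {x} (carrier G)"
  have C: "subgroup ?C G"
    using x by (intro subgroup_centralizer subgroup_self) auto
  \<comment> \<open>Left to right, this makes the map on cosets independent of the representative
    chosen by \<open>SOME\<close>; right to left, it makes the map injective.\<close>
  have *: "?C #> g = ?C #> h \<longleftrightarrow> inv g \<otimes> x \<otimes> g = inv h \<otimes> x \<otimes> h"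
    if g: "g \<in> carrier G" and h: "h \<in> carrier G" for g h
  proof -
    have "?C #> g = ?C #> h \<longleftrightarrow> g \<in> ?C #> h"
      using g h by (metis C rcos_self repr_independence)
    also have "\<dots> \<longleftrightarrow> g \<otimes> inv h \<in> ?C"
      using g h by (simp add: subgroup.rcos_module [OF C is_group])
    also have "\<dots> \<longleftrightarrow> inv (g \<otimes> inv h) \<otimes> x \<otimes> (g \<otimes> inv h) = x"
      using g h x by (auto simp: conj_eq_iff_commute centralizer_def)
    also have "\<dots> \<longleftrightarrow> h \<otimes> (inv g \<otimes> x \<otimes> g) \<otimes> inv h = x"
      using g h x by (simp add: inv_mult_group m_assoc)
    also have "\<dots> \<longleftrightarrow> h \<otimes> (inv g \<otimes> x \<otimes> g) = x \<otimes> h"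
      using g h x by (intro inv_solve_right') auto
    also have "\<dots> \<longleftrightarrow> inv g \<otimes> x \<otimes> g = inv h \<otimes> (x \<otimes> h)"
      using g h x by (subst inv_solve_left) auto
    also have "inv h \<otimes> (x \<otimes> h) = inv h \<otimes> x \<otimes> h"
      using g h x by (simp add: m_assoc)
    finally show ?thesis .
  qed
  have "bij_betw (\<lambda>Q. inv (SOME g. g \<in> carrier G \<and> Q = ?C #> g) \<otimes> x
      \<otimes> (SOME g. g \<in> carrier G \<and> Q = ?C #> g))
      (rcosets ?C) (conjugacy_class G x)"
    (is "bij_betw ?f _ _")
  proof -
    have f: "?f (?C #> g) = inv g \<otimes> x \<otimes> g" if g: "g \<in> carrier G" for g
    proof -
      let ?h = "SOME h. h \<in> carrier G \<and> ?C #> g = ?C #> h"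
      have "?h \<in> carrier G \<and> ?C #> g = ?C #> ?h"
        by (rule someI_ex) (use g in blast)
      then show ?thesis
        using * [of g ?h] g by simp
    qed
    show ?thesis
    proof (rule bij_betw_imageI)
      show "inj_on ?f (rcosets ?C)"
        by (auto simp: inj_on_def RCOSETS_def f *)
      show "?f ` (rcosets ?C) = conjugacy_class G x"
        by (auto simp: RCOSETS_def conjugacy_class_def f image_iff)
    qed
  qed
  then show ?thesis
    by (simp add: finite_index_def bij_betw_finite)
qed

section \<open>Topological groups\<close>

lemma (in topological_group) continuous_map_mult [continuous_intros]:
  assumes "continuous_map X T f" "continuous_map X T g"
  shows "continuous_map X T (\<lambda>x. f x \<otimes> g x)"
  using continuous_map_compose [OF continuous_map_pairedI [OF assms] continuous_mult]
  by (simp add: o_def)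

lemma (in topological_group) continuous_map_m_inv [continuous_intros]:
  assumes "continuous_map X T f"
  shows "continuous_map X T (\<lambda>x. inv (f x))"
  using continuous_map_compose [OF assms continuous_inv] by (simp add: o_def)

lemma (in topological_group) l_coset_eq_preimage:
  assumes "A \<subseteq> carrier G" "g \<in> carrier G"
  shows "g <# A = {x \<in> topspace T. inv g \<otimes> x \<in> A}"
  using assms by (auto simp: mem_l_coset_iff topspace_eq_carrier)

lemma (in topological_group) openin_l_coset:
  assumes "openin T U" "g \<in> carrier G"
  shows "openin T (g <# U)"
proof -
  have "openin T {x \<in> topspace T. inv g \<otimes> x \<in> U}"
    by (rule openin_continuous_map_preimage [OF _ assms(1)])
      (use assms in \<open>intro continuous_intros; simp add: topspace_eq_carrier\<close>)
  then show ?thesis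
    using assms by (metis l_coset_eq_preimage openin_subset topspace_eq_carrier)
qed

lemma (in topological_group) closedin_l_coset:
  assumes "closedin T U" "g \<in> carrier G"
  shows "closedin T (g <# U)"
proof -
  have "closedin T {x \<in> topspace T. inv g \<otimes> x \<in> U}"
    by (rule closedin_continuous_map_preimage [OF _ assms(1)])
      (use assms in \<open>intro continuous_intros; simp add: topspace_eq_carrier\<close>)
  then show ?thesis
    using assms by (metis l_coset_eq_preimage closedin_subset topspace_eq_carrier)
qed

section \<open>Open subgroups, closed subgroups and finite index\<close>

text \<open>Translating \<open>V\<close> by \<open>h\<close> gives an open neighbourhood of
  \<open>h\<close> inside the subgroup.\<close>

lemma (in topological_group) openin_subgroup:
  assumes H: "subgroup H G" and V: "openin T V" "\<one> \<in> V" "V \<subseteq> H"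
  shows "openin T H"
proof (subst openin_subopen, intro ballI)
  fix h assume h: "h \<in> H"
  have HG: "H \<subseteq> carrier G" using H subgroup.subset by blast
  have "openin T (h <# V)"
    using V h HG by (intro openin_l_coset) auto
  moreover have "h \<in> h <# V"
    using V h HG by (subst mem_l_coset_iff) auto
  moreover have "h <# V \<subseteq> H"
    using V h H by (auto simp: l_coset_def subgroup.m_closed)
  ultimately show "\<exists>U. openin T U \<and> h \<in> U \<and> U \<subseteq> H" by blast
qed

lemma (in group) l_coset_subgroup_disjoint:
  assumes H: "subgroup H G" and g: "g \<in> carrier G" "g \<notin> H"
  shows "(g <# H) \<inter> H = {}"
proof -
  have HG: "H \<subseteq> carrier G" using H subgroup.subset by blast
  have False if x: "x \<in> H" "inv g \<otimes> x \<in> H" for x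
  proof -
    have "x \<otimes> inv (inv g \<otimes> x) \<in> H"
      using x H by (auto intro: subgroup.m_closed subgroup.m_inv_closed)
    moreover have "x \<otimes> inv (inv g \<otimes> x) = g"
      using x g HG by (auto simp: inv_mult_group simp flip: m_assoc)
    ultimately show False using g by simp
  qed
  then show ?thesis
    using g HG by (auto simp: mem_l_coset_iff)
qed

lemma (in group) mem_l_coset_self:
  assumes H: "subgroup H G" and g: "g \<in> carrier G"
  shows "g \<in> g <# H"
  using assms by (subst mem_l_coset_iff) (auto simp: subgroup.one_closed subgroup.subset)

text \<open>The complement is a union of cosets, all of them open.\<close>

lemma (in topological_group) closedin_open_subgroup:
  assumes H: "subgroup H G" and "openin T H"
  shows "closedin T H"
proof -
  have HG: "H \<subseteq> carrier G" using H subgroup.subset by blast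
  have "topspace T - H = (\<Union>g\<in>carrier G - H. g <# H)"
    using l_coset_subgroup_disjoint [OF H] mem_l_coset_self [OF H] l_coset_subset_G [OF HG]
    by (fastforce simp: topspace_eq_carrier)
  moreover have "openin T (\<Union>g\<in>carrier G - H. g <# H)"
    using assms by (auto intro: openin_l_coset)
  ultimately show ?thesis
    using HG by (simp add: closedin_def topspace_eq_carrier)
qed

text \<open>The complement is a union of finitely many cosets, all of them closed.\<close>

lemma (in topological_group) openin_closed_subgroup:
  assumes H: "subgroup H G" and "closedin T H" and fin: "finite_index G (carrier G) H"
  shows "openin T H"
proof -
  have HG: "H \<subseteq> carrier G" using H subgroup.subset by blast
  obtain R where R: "R \<subseteq> carrier G" "finite R"
    "disjoint_family_on (\<lambda>r. r <# H) R" "(\<Union>r\<in>R. r <# H) = carrier G"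
    using left_transversal [OF subgroup_self H HG] fin by metis
  have coset_sub: "g <# H \<subseteq> H" if "g \<in> H" for g
    using that H by (auto simp: l_coset_def subgroup.m_closed)
  \<comment> \<open>A representative lying in \<open>H\<close> has its coset inside
    \<open>H\<close>, so \<open>R - H\<close> indexes the complement.\<close>
  have "H = topspace T - (\<Union>r\<in>R - H. r <# H)"
  proof (intro equalityI subsetI)
    fix x assume "x \<in> H"
    then show "x \<in> topspace T - (\<Union>r\<in>R - H. r <# H)"
      using l_coset_subgroup_disjoint [OF H] R(1) HG by (auto simp: topspace_eq_carrier)
  next
    fix x assume x: "x \<in> topspace T - (\<Union>r\<in>R - H. r <# H)"
    then obtain r where "r \<in> R" "x \<in> r <# H"
      using R(4) by (auto simp: topspace_eq_carrier)
    then show "x \<in> H"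
      using x coset_sub by auto
  qed
  moreover have "closedin T (\<Union>r\<in>R - H. r <# H)"
    using assms R by (intro closedin_Union) (auto intro: closedin_l_coset)
  ultimately show ?thesis
    by (metis openin_diff openin_topspace)
qed

text \<open>The cosets form a disjoint open cover of a compact space by nonempty sets, so the cover
  is finite.\<close>

lemma (in compact_group) finite_index_open_subgroup:
  assumes H: "subgroup H G" and "openin T H"
  shows "finite_index G (carrier G) H"
proof -
  have HG: "H \<subseteq> carrier G" using H subgroup.subset by blast
  obtain R where R: "R \<subseteq> carrier G" "finite R \<longleftrightarrow> finite_index G (carrier G) H"
    "disjoint_family_on (\<lambda>r. r <# H) R" "(\<Union>r\<in>R. r <# H) = carrier G"
    using left_transversal [OF subgroup_self H HG] by metis
  have "\<exists>Q. finite Q \<and> Q \<subseteq> (\<lambda>r. r <# H) ` R \<and> topspace T \<subseteq> \<Union>Q"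
    using R assms
    by (intro compactinD [OF compact [unfolded compact_space_def]])
      (auto simp: topspace_eq_carrier intro: openin_l_coset)
  then obtain Q where Q: "finite Q" "Q \<subseteq> (\<lambda>r. r <# H) ` R" "topspace T \<subseteq> \<Union>Q"
    by blast
  obtain S where S: "finite S" "S \<subseteq> R" "Q = (\<lambda>r. r <# H) ` S"
    using finite_subset_image [OF Q(1,2)] by blast
  \<comment> \<open>The point \<open>r\<close> lies in its own coset and, by disjointness, in no
    other, so a subcover cannot omit that coset.\<close>
  have "r \<in> S" if r: "r \<in> R" for r
  proof -
    have "r \<in> topspace T"
      using r R by (auto simp: topspace_eq_carrier)
    then obtain s where s: "s \<in> S" "r \<in> s <# H"
      using Q S by auto
    moreover have "r \<in> r <# H"
      using r R by (intro mem_l_coset_self [OF H]) auto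
    ultimately show ?thesis
      using r R(3) S(2) disjoint_family_onD [of "\<lambda>r. r <# H" R r s] by blast
  qed
  then show ?thesis
    using S R finite_subset [of R S] by blast
qed

text \<open>Multiplication and inversion act coordinatewise. This lets \<open>P\<close> be treated
  as the Haar measure of a topological group.\<close>

lemma topological_group_DirProd:
  assumes "topological_group G S" "topological_group H T"
  shows "topological_group (G \<times>\<times> H) (prod_topology S T)"
proof -
  interpret G: topological_group G S by fact
  interpret H: topological_group H T by fact
  interpret GH: group "G \<times>\<times> H"
    by (rule DirProd_group) unfold_locales
  show ?thesis
  proof
    show "topspace (prod_topology S T) = carrier (G \<times>\<times> H)"
      by (simp add: G.topspace_eq_carrier H.topspace_eq_carrier)
    let ?X = "prod_topology (prod_topology S T) (prod_topology S T)"
    have fst: "continuous_map ?X S (\<lambda>z. fst (fst z))" "continuous_map ?X S (\<lambda>z. fst (snd z))"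
      and snd: "continuous_map ?X T (\<lambda>z. snd (fst z))" "continuous_map ?X T (\<lambda>z. snd (snd z))"
      using continuous_map_compose [OF continuous_map_fst continuous_map_fst, of S T]
        continuous_map_compose [OF continuous_map_snd continuous_map_fst, of _ S T]
        continuous_map_compose [OF continuous_map_fst continuous_map_snd, of S T]
        continuous_map_compose [OF continuous_map_snd continuous_map_snd, of _ S T]
      by (simp_all add: o_def)
    have "continuous_map ?X (prod_topology S T)
        (\<lambda>z. (fst (fst z) \<otimes>\<^bsub>G\<^esub> fst (snd z), snd (fst z) \<otimes>\<^bsub>H\<^esub> snd (snd z)))"
      by (intro continuous_map_pairedI G.continuous_map_mult H.continuous_map_mult fst snd)
    then show "continuous_map ?X (prod_topology S T) (\<lambda>(x, y). x \<otimes>\<^bsub>G \<times>\<times> H\<^esub> y)"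
      by (simp add: case_prod_unfold mult_DirProd')
    have "continuous_map (prod_topology S T) (prod_topology S T)
        (\<lambda>z. (inv\<^bsub>G\<^esub> fst z, inv\<^bsub>H\<^esub> snd z))"
      by (intro continuous_map_pairedI G.continuous_map_m_inv H.continuous_map_m_inv
          continuous_map_fst continuous_map_snd)
    then show "continuous_map (prod_topology S T) (prod_topology S T) (\<lambda>x. inv\<^bsub>G \<times>\<times> H\<^esub> x)"
      by (rule continuous_map_eq)
        (auto simp: G.topspace_eq_carrier H.topspace_eq_carrier)
  qed
qed

section \<open>Closed centralizers and closed levels of the FC-center\<close>

lemma (in compact_group) closedin_centralizer:
  assumes "x \<in> carrier G"
  shows "closedin T (centralizer G {x} (carrier G))"
proof -
  have "closedin T {g \<in> topspace T. g \<otimes> x = x \<otimes> g}"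
    by (rule closedin_continuous_maps_eq [OF hausdorff])
      (use assms in \<open>intro continuous_intros; simp add: topspace_eq_carrier\<close>)+
  then show ?thesis
    by (simp add: centralizer_def topspace_eq_carrier)
qed

text \<open>Some \<open>n + 1\<close> elements conjugate \<open>x\<close> to distinct elements.
  These are finitely many inequalities between continuous functions of \<open>x\<close>, so they
  persist nearby. One set \<open>Y\<close> thus serves all of \<open>W\<close>, which the measure
  estimates rely on.\<close>

lemma (in compact_group) FC_level_complement_nbhd:
  assumes x: "x \<in> carrier G" "x \<notin> FC_level G n"
  obtains W Y where "openin T W" "x \<in> W" "Y \<subseteq> carrier G" "finite Y" "card Y = Suc n"
    "\<And>w. w \<in> W \<Longrightarrow> inj_on (\<lambda>y. inv y \<otimes> w \<otimes> y) Y"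
proof -
  let ?c = "\<lambda>w y. inv y \<otimes> w \<otimes> y"
  have "\<exists>C \<subseteq> conjugacy_class G x. finite C \<and> card C = Suc n"
  proof (cases "finite (conjugacy_class G x)")
    case True
    then have "Suc n \<le> card (conjugacy_class G x)"
      using x by (auto simp: FC_level_def)
    then show ?thesis
      by (meson obtain_subset_with_card_n)
  next
    case False
    then show ?thesis
      by (meson infinite_arbitrarily_large)
  qed
  then obtain C where C: "C \<subseteq> ?c x ` carrier G" "finite C" "card C = Suc n"
    by (auto simp: conjugacy_class_def image_def Bex_def)
  then obtain Y where Y: "Y \<subseteq> carrier G" "inj_on (?c x) Y" "C = ?c x ` Y"
    by (meson subset_image_inj)
  \<comment> \<open>For \<open>n = 0\<close> the set \<open>Y\<close> has one element and the family
    of inequalities is empty; intersecting with \<open>topspace T\<close> keeps \<open>W\<close>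
    inside the group.\<close>
  define W where "W = topspace T \<inter> (\<Inter>(y, z)\<in>{(y, z) \<in> Y \<times> Y. y \<noteq> z}.
    {w \<in> topspace T. ?c w y \<noteq> ?c w z})"
  have finY: "finite Y"
    using Y C by (metis finite_imageD)
  show thesis
  proof
    have "openin T {w \<in> topspace T. ?c w y \<noteq> ?c w z}" if "y \<in> Y" "z \<in> Y" for y z
    proof -
      have "closedin T {w \<in> topspace T. ?c w y = ?c w z}"
        by (rule closedin_continuous_maps_eq [OF hausdorff])
          (use that Y in \<open>intro continuous_intros; auto simp: topspace_eq_carrier\<close>)+
      moreover have "{w \<in> topspace T. ?c w y \<noteq> ?c w z} = topspace T - {w \<in> topspace T. ?c w y = ?c w z}"
        by auto
      ultimately show ?thesis by auto
    qed
    moreover have "finite {(y, z) \<in> Y \<times> Y. y \<noteq> z}"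
      by (rule finite_subset [of _ "Y \<times> Y"]) (use finY in auto)
    ultimately show "openin T W"
      unfolding W_def by (intro openin_Int_Inter) auto
    show "x \<in> W"
      using x Y by (auto simp: W_def topspace_eq_carrier inj_on_def)
    show "Y \<subseteq> carrier G" "finite Y" "card Y = Suc n"
      using Y C finY by (auto simp: card_image)
    show "inj_on (?c w) Y" if "w \<in> W" for w
      using that by (auto simp: W_def inj_on_def)
  qed
qed

lemma (in group) notin_FC_level:
  assumes "w \<in> carrier G" "Y \<subseteq> carrier G" "finite Y" "card Y = Suc n"
    "inj_on (\<lambda>y. inv y \<otimes> w \<otimes> y) Y"
  shows "w \<notin> FC_level G n"
proof
  assume w: "w \<in> FC_level G n"
  have "(\<lambda>y. inv y \<otimes> w \<otimes> y) ` Y \<subseteq> conjugacy_class G w"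
    using assms by (auto simp: conjugacy_class_def)
  then have "card Y \<le> card (conjugacy_class G w)"
    using w assms by (metis (no_types, lifting) FC_level_def card_image card_mono mem_Collect_eq)
  with w assms show False
    by (auto simp: FC_level_def)
qed

text \<open>The neighbourhoods just constructed miss the level. Closedness makes the levels
  available to measure arguments.\<close>

lemma (in compact_group) closedin_FC_level: "closedin T (FC_level G n)"
proof -
  have "openin T (topspace T - FC_level G n)"
  proof (subst openin_subopen, intro ballI)
    fix x assume "x \<in> topspace T - FC_level G n"
    then obtain W Y where W: "openin T W" "x \<in> W" and Y: "Y \<subseteq> carrier G" "finite Y"
        "card Y = Suc n" "\<And>w. w \<in> W \<Longrightarrow> inj_on (\<lambda>y. inv y \<otimes> w \<otimes> y) Y"
      using FC_level_complement_nbhd [of x n] by (auto simp: topspace_eq_carrier)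
    have "W \<subseteq> topspace T" using W openin_subset by blast
    then have "W \<subseteq> topspace T - FC_level G n"
      using notin_FC_level [OF _ Y(1-3)] Y(4) by (auto simp: topspace_eq_carrier)
    with W show "\<exists>U. openin T U \<and> x \<in> U \<and> U \<subseteq> topspace T - FC_level G n" by blast
  qed
  moreover have "FC_level G n \<subseteq> topspace T"
    by (auto simp: FC_level_def topspace_eq_carrier)
  ultimately show ?thesis by (simp add: closedin_def)
qed

text \<open>B. H. Neumann's argument: let \<open>a \<in> V\<close> have as many \<open>F\<close>-conjugates as possible. If \<open>u\<close> is
  close to \<open>\<one>\<close>, it commutes with elements \<open>y\<close> that produce all the conjugates of \<open>a\<close>, so the elements
  \<open>u (y\<^sup>-\<^sup>1 a y)\<close> exhaust the conjugates of \<open>u a\<close>. Hence the commutators of \<open>u\<close> with \<open>F\<close> lie in a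
  finite set that does not depend on \<open>u\<close>; by compactness of \<open>F\<close> they are trivial for \<open>u\<close> near \<open>\<one>\<close>.\<close>

lemma (in compact_group) openin_center_FC_center:
  assumes V: "openin T V" "\<one> \<in> V" "V \<subseteq> FC_level G n"
  shows "openin T (centralizer G (FC_center G) (FC_center G))"
proof -
  define F where "F = FC_center G"
  have F: "subgroup F G" and FG: "F \<subseteq> carrier G"
    unfolding F_def by (rule subgroup_FC_center, rule FC_center_subset)
  have VF: "V \<subseteq> F"
    unfolding F_def using V(3) by (rule subset_trans) (rule FC_level_subset_FC_center)
  have oF: "openin T F"
    by (rule openin_subgroup [OF F V(1,2) VF])
  define cls where "cls a = (\<lambda>g. inv g \<otimes> a \<otimes> g) ` F" for a
  have cls: "finite (cls a)" "card (cls a) \<le> n" if "a \<in> V" for a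
  proof -
    have sub: "cls a \<subseteq> conjugacy_class G a"
      using FG by (auto simp: cls_def conjugacy_class_def)
    have fin: "finite (conjugacy_class G a)" "card (conjugacy_class G a) \<le> n"
      using that V(3) by (auto simp: FC_level_def)
    show "finite (cls a)" "card (cls a) \<le> n"
      using finite_subset [OF sub fin(1)] card_mono [OF fin(1) sub] fin(2) by auto
  qed
  obtain a where a: "a \<in> V" and max: "\<And>b. b \<in> V \<Longrightarrow> card (cls b) \<le> card (cls a)"
    using Lattices_Big.ex_has_greatest_nat [of "\<lambda>a. a \<in> V" \<one> "\<lambda>a. card (cls a)" "Suc n"]
      V(2) cls(2) by (auto simp: less_Suc_eq_le)
  have aG: "a \<in> carrier G" using a VF FG by auto
  obtain Y where Y: "Y \<subseteq> F" "inj_on (\<lambda>g. inv g \<otimes> a \<otimes> g) Y" "cls a = (\<lambda>g. inv g \<otimes> a \<otimes> g) ` Y"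
    using subset_image_inj [of "cls a" "\<lambda>g. inv g \<otimes> a \<otimes> g" F] by (auto simp: cls_def)
  have finY: "finite Y"
    using cls(1) [OF a] Y by (simp add: finite_image_iff)
  \<comment> \<open>Quotients of two \<open>F\<close>-conjugates of \<open>a\<close>: the finite set
    that will contain all commutators of \<open>N\<close> with \<open>F\<close>.\<close>
  define S where "S = (\<lambda>(p, q). p \<otimes> inv q) ` (cls a \<times> cls a)"
  have clsG: "cls b \<subseteq> carrier G" if "b \<in> carrier G" for b
    using that FG by (auto simp: cls_def)
  have finS: "finite S" and SG: "S \<subseteq> carrier G"
    unfolding S_def using cls(1) [OF a] clsG [OF aG] by auto
  \<comment> \<open>The precise meaning of \<open>u\<close> being close to \<open>\<one>\<close>.
    Both conditions are open: each \<open>y\<close> lies in the FC-center, so its centralizer is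
    closed of finite index.\<close>
  define N where "N = {u \<in> topspace T. u \<otimes> a \<in> V} \<inter> (\<Inter>y\<in>Y. centralizer G {y} (carrier G))"
  have oN: "openin T N"
  proof -
    have "openin T {u \<in> topspace T. u \<otimes> a \<in> V}"
      by (rule openin_continuous_map_preimage [OF _ V(1)])
        (use aG in \<open>intro continuous_intros; simp add: topspace_eq_carrier\<close>)
    moreover have "openin T (centralizer G {y} (carrier G))" if "y \<in> Y" for y
    proof -
      have y: "y \<in> carrier G" "finite (conjugacy_class G y)"
        using that Y(1) by (auto simp: F_def FC_center_def)
      then show ?thesis
        by (intro openin_closed_subgroup subgroup_centralizer subgroup_self closedin_centralizer)
          (auto simp: finite_index_centralizer_iff)
    qed
    ultimately show ?thesis
      unfolding N_def using finY by (intro openin_Int_Inter) auto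
  qed
  have oneN: "\<one> \<in> N"
    using a aG Y(1) FG by (auto simp: N_def topspace_eq_carrier centralizer_def)
  have NS: "inv u \<otimes> (inv g \<otimes> u \<otimes> g) \<in> S" if u: "u \<in> N" and g: "g \<in> F" for u g
  proof -
    have uG: "u \<in> carrier G" and uaV: "u \<otimes> a \<in> V"
      using u by (auto simp: N_def topspace_eq_carrier)
    have gG: "g \<in> carrier G" using g FG by auto
    have "inv y \<otimes> (u \<otimes> a) \<otimes> y = u \<otimes> (inv y \<otimes> a \<otimes> y)" if y: "y \<in> Y" for y
    proof -
      have yG: "y \<in> carrier G" using y Y FG by auto
      have "u \<otimes> y = y \<otimes> u"
        using u y by (auto simp: N_def centralizer_def)
      then have "inv y \<otimes> u \<otimes> y = u"
        using uG yG by (simp add: conj_eq_iff_commute)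
      then show ?thesis
        using conj_mult [OF uG aG yG] by simp
    qed
    then have sub: "(\<lambda>b. u \<otimes> b) ` cls a \<subseteq> cls (u \<otimes> a)"
      unfolding Y(3) using Y(1) by (auto simp: cls_def image_iff) (metis subsetD)
    have "inj_on (\<lambda>b. u \<otimes> b) (cls a)"
      using uG clsG [OF aG] by (auto simp: inj_on_def subset_iff)
    then have "card ((\<lambda>b. u \<otimes> b) ` cls a) = card (cls a)"
      by (rule card_image)
    \<comment> \<open>The translated class already has the maximal size, so the inclusion into
      \<open>cls (u \<otimes> a)\<close> is an equality.\<close>
    then have eq: "(\<lambda>b. u \<otimes> b) ` cls a = cls (u \<otimes> a)"
      using card_seteq [OF cls(1) [OF uaV] sub] max [OF uaV] by simp
    have "inv g \<otimes> (u \<otimes> a) \<otimes> g \<in> cls (u \<otimes> a)"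
      using g by (auto simp: cls_def)
    then obtain b where b: "b \<in> cls a" "inv g \<otimes> (u \<otimes> a) \<otimes> g = u \<otimes> b"
      unfolding eq [symmetric] by auto
    define c where "c = inv g \<otimes> a \<otimes> g"
    have c: "c \<in> cls a" "c \<in> carrier G"
      using g gG aG by (auto simp: cls_def c_def)
    have bG: "b \<in> carrier G" using b clsG [OF aG] by auto
    have "(inv g \<otimes> u \<otimes> g) \<otimes> c = u \<otimes> b"
      using b conj_mult [OF uG aG gG] by (simp add: c_def)
    then have "inv g \<otimes> u \<otimes> g = u \<otimes> b \<otimes> inv c"
      using uG gG bG c by (subst inv_solve_right) auto
    then have "inv u \<otimes> (inv g \<otimes> u \<otimes> g) = b \<otimes> inv c"
      using uG gG bG c by (simp add: inv_solve_left' m_assoc)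
    then show ?thesis
      using b c by (auto simp: S_def)
  qed
  \<comment> \<open>Pairs whose commutator avoids the nontrivial elements of \<open>S\<close>. This
    open set contains \<open>{\<one>} \<times> F\<close>, so the tube lemma yields a neighbourhood
    of \<open>\<one>\<close> that works for all of \<open>F\<close> at once.\<close>
  define W where "W = {z \<in> topspace (prod_topology T T).
    inv (fst z) \<otimes> (inv (snd z) \<otimes> fst z \<otimes> snd z) \<in> topspace T - (S - {\<one>})}"
  have "closedin T (S - {\<one>})"
    using finS SG hausdorff
    by (intro closedin_Hausdorff_finite) (auto simp: topspace_eq_carrier)
  then have "openin (prod_topology T T) W"
    unfolding W_def
    by (intro openin_continuous_map_preimage [where Y = T] openin_diff openin_topspace
        continuous_map_mult continuous_map_m_inv continuous_map_fst continuous_map_snd)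
  moreover have "compactin T F"
    using closedin_open_subgroup [OF F oF] compact by (rule closedin_compact_space [rotated])
  moreover have "{\<one>} \<times> F \<subseteq> W"
    using FG by (auto simp: W_def topspace_eq_carrier)
  ultimately obtain U X where U: "openin T U" "\<one> \<in> U" "F \<subseteq> X" "U \<times> X \<subseteq> W"
    using tube_lemma_right [of T T W F \<one>] by (auto simp: topspace_eq_carrier)
  have "U \<inter> N \<inter> F \<subseteq> centralizer G F F"
  proof
    fix u assume u: "u \<in> U \<inter> N \<inter> F"
    have uG: "u \<in> carrier G" using u FG by auto
    have "u \<otimes> g = g \<otimes> u" if g: "g \<in> F" for g
    proof -
      have gG: "g \<in> carrier G" using g FG by auto
      have "(u, g) \<in> W" using u g U by auto
      then have "inv u \<otimes> (inv g \<otimes> u \<otimes> g) = \<one>"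
        using NS [of u g] u g by (auto simp: W_def)
      then show ?thesis
        using uG gG by (simp add: inv_solve_left' conj_eq_iff_commute)
    qed
    then show "u \<in> centralizer G F F"
      using u by (auto simp: centralizer_def)
  qed
  moreover have "openin T (U \<inter> N \<inter> F)"
    using U oN oF by auto
  moreover have "\<one> \<in> U \<inter> N \<inter> F"
    using U oneN subgroup.one_closed [OF F] by auto
  ultimately show ?thesis
    using openin_subgroup [OF subgroup_centralizer [OF FG F]] by (simp add: F_def)
qed

section \<open>Haar measure\<close>

text \<open>The group is kept general because the locale will be interpreted for the square
  \<open>G \<times>\<times> G\<close>.\<close>

locale haar_group = topological_group G T for G (structure) and T +
  fixes M
  assumes haar: "normalized_haar_measure G T M"
begin

lemma sets_haar: "sets M = sigma_sets (topspace T) {U. openin T U}"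
  using haar openin_subset [of T]
  by (auto simp: normalized_haar_measure_def borel_of_def intro!: sets_measure_of)

lemma space_haar: "space M = carrier G"
proof -
  have "space M = space (borel_of T)"
    using haar by (intro sets_eq_imp_space_eq) (simp add: normalized_haar_measure_def)
  then show ?thesis
    by (simp add: borel_of_def space_measure_of_conv topspace_eq_carrier)
qed

lemma openin_sets [intro]: "openin T U \<Longrightarrow> U \<in> sets M"
  by (auto simp: sets_haar)

lemma closedin_sets [intro]:
  assumes "closedin T U" shows "U \<in> sets M"
proof -
  have "topspace T - (topspace T - U) \<in> sets M"
    using assms by (intro sets.Diff openin_sets) auto
  moreover have "topspace T - (topspace T - U) = U"
    using closedin_subset [OF assms] by auto
  ultimately show ?thesis by simp
qed

sublocale finite_measure M
  using haar by (intro finite_measureI) (simp add: normalized_haar_measure_def)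

lemma measure_carrier: "measure M (carrier G) = 1"
  using haar unfolding space_haar [symmetric] by (simp add: normalized_haar_measure_def measure_def)

text \<open>The translate is the preimage of \<open>A\<close> under the continuous, hence Borel
  measurable, translation by \<open>inv g\<close>.\<close>

lemma l_coset_sets:
  assumes A: "A \<in> sets M" and g: "g \<in> carrier G"
  shows "g <# A \<in> sets M"
proof -
  have "continuous_map T T (\<lambda>x. inv g \<otimes> x)"
    using g by (intro continuous_intros) (simp add: topspace_eq_carrier)
  then have "(\<lambda>x. inv g \<otimes> x) -` U \<inter> space M \<in> sets M" if "openin T U" for U
    using openin_continuous_map_preimage [of T T _ U] that
    by (auto simp: space_haar vimage_def Int_def conj_commute topspace_eq_carrier)
  then have "(\<lambda>x. inv g \<otimes> x) \<in> measurable M (sigma (topspace T) {U. openin T U})"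
    using g openin_subset [of T]
    by (intro measurable_measure_of) (auto simp: space_haar topspace_eq_carrier)
  then have "(\<lambda>x. inv g \<otimes> x) -` A \<inter> space M \<in> sets M"
    by (rule measurable_sets) (use A haar in \<open>simp add: normalized_haar_measure_def borel_of_def\<close>)
  moreover have "(\<lambda>x. inv g \<otimes> x) -` A \<inter> space M = g <# A"
    using g sets.sets_into_space [OF A]
    by (subst l_coset_eq_preimage) (auto simp: space_haar topspace_eq_carrier)
  ultimately show ?thesis by simp
qed

lemma measure_l_coset:
  assumes "A \<in> sets M" "g \<in> carrier G"
  shows "measure M (g <# A) = measure M A"
  using haar assms by (simp add: normalized_haar_measure_def measure_def)

lemma measure_disjoint_translates:
  assumes A: "A \<in> sets M" and R: "finite R" "R \<subseteq> carrier G"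
    and disj: "disjoint_family_on (\<lambda>r. r <# A) R"
  shows "measure M (\<Union>r\<in>R. r <# A) = card R * measure M A"
proof -
  have "measure M (\<Union>r\<in>R. r <# A) = (\<Sum>r\<in>R. measure M (r <# A))"
    using A R disj l_coset_sets
    by (intro finite_measure_finite_Union) auto
  also have "\<dots> = (\<Sum>r\<in>R. measure M A)"
    using A R by (intro sum.cong) (auto simp: measure_l_coset)
  finally show ?thesis by simp
qed

text \<open>Finitely many translates of \<open>U\<close> cover the group, so a finite multiple of
  the measure of \<open>U\<close> is at least 1.\<close>

lemma measure_open_pos:
  assumes compact: "compact_space T" and U: "openin T U" "U \<noteq> {}"
  shows "measure M U > 0"
proof -
  obtain u where u: "u \<in> U" using U by auto
  have UG: "U \<subseteq> carrier G" using openin_subset [OF U(1)] by (simp add: topspace_eq_carrier)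
  \<comment> \<open>The translate of \<open>U\<close> that carries \<open>u\<close> to
    \<open>g\<close>.\<close>
  define c where "c g = (g \<otimes> inv u) <# U" for g
  have "\<exists>Q. finite Q \<and> Q \<subseteq> c ` carrier G \<and> topspace T \<subseteq> \<Union>Q"
  proof (rule compactinD [OF compact [unfolded compact_space_def]])
    have "g \<in> c g" if "g \<in> carrier G" for g
      using that u UG by (auto simp: c_def mem_l_coset_iff inv_mult_group m_assoc subset_iff)
    then show "topspace T \<subseteq> \<Union> (c ` carrier G)"
      by (auto simp: topspace_eq_carrier)
    show "openin T X" if "X \<in> c ` carrier G" for X
      using that u UG U(1) by (auto simp: c_def intro!: openin_l_coset)
  qed
  then obtain Q where Q: "finite Q" "Q \<subseteq> c ` carrier G" "topspace T \<subseteq> \<Union>Q" by blast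
  have m: "X \<in> sets M \<and> measure M X = measure M U" if X: "X \<in> Q" for X
  proof -
    obtain g where g: "g \<in> carrier G" "X = c g"
      using X Q(2) by auto
    then have "g \<otimes> inv u \<in> carrier G"
      using u UG by auto
    with g U(1) show ?thesis
      by (auto simp: c_def intro!: measure_l_coset l_coset_sets)
  qed
  have "1 = measure M (carrier G)"
    by (simp add: measure_carrier)
  also have "\<dots> \<le> measure M (\<Union>X\<in>Q. X)"
    using Q m by (intro finite_measure_mono) (auto simp: space_haar topspace_eq_carrier)
  also have "\<dots> \<le> (\<Sum>X\<in>Q. measure M X)"
    using Q m by (intro finite_measure_subadditive_finite) auto
  also have "\<dots> = card Q * measure M U"
    using m by simp
  finally show ?thesis
    by (metis measure_nonneg less_eq_real_def mult_zero_right not_one_le_zero)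
qed

lemma outer_regular:
  assumes "A \<in> sets M" "measure M A < c"
  obtains U where "openin T U" "A \<subseteq> U" "measure M U < c"
proof -
  have "emeasure M A < ennreal c"
    using assms by (simp add: emeasure_eq_measure ennreal_less_iff)
  moreover have "emeasure M A = (INF U\<in>{U. openin T U \<and> A \<subseteq> U}. emeasure M U)"
    using haar assms by (simp add: normalized_haar_measure_def)
  ultimately obtain U where U: "openin T U" "A \<subseteq> U" "emeasure M U < ennreal c"
    by (auto simp: INF_less_iff)
  then have "measure M U < c"
    by (simp add: emeasure_eq_measure ennreal_less_iff)
  with U that show thesis by blast
qed

lemma inner_regular:
  assumes "openin T U" "c < measure M U" "0 \<le> c"
  obtains K where "compactin T K" "K \<subseteq> U" "ennreal c < emeasure M K"
proof -
  have "ennreal c < emeasure M U"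
    using assms by (simp add: emeasure_eq_measure ennreal_less_iff)
  moreover have "emeasure M U = (SUP K\<in>{K. compactin T K \<and> K \<subseteq> U}. emeasure M K)"
    using haar assms by (simp add: normalized_haar_measure_def)
  ultimately obtain K where "compactin T K" "K \<subseteq> U" "ennreal c < emeasure M K"
    by (auto simp: less_SUP_iff)
  with that show thesis by blast
qed

end

section \<open>The measure of the set of commuting pairs\<close>

text \<open>The measure \<open>P\<close> on pairs is the only one in use: a set \<open>A\<close> of
  group elements is measured through the box \<open>A \<times> carrier G\<close>.\<close>

locale haar_square = compact_group G T + square: haar_group "G \<times>\<times> G" "prod_topology T T" P
  for G (structure) and T and P
begin

definition commuting_pairs :: "('a \<times> 'a) set" where
  "commuting_pairs = {(x, y) \<in> carrier G \<times> carrier G. x \<otimes> y = y \<otimes> x}"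

lemma commutativity_degree_eq: "commutativity_degree G P = measure P commuting_pairs"
  unfolding commutativity_degree_def commuting_pairs_def
  by (rule arg_cong [of _ _ "measure P"]) (auto simp: commutator_eq_one_iff)

lemma sets_commuting_pairs [intro]: "commuting_pairs \<in> sets P"
proof -
  have "closedin (prod_topology T T)
      {z \<in> topspace (prod_topology T T). fst z \<otimes> snd z = snd z \<otimes> fst z}"
    by (rule closedin_continuous_maps_eq [OF hausdorff])
      (intro continuous_map_mult continuous_map_fst continuous_map_snd)+
  then have "{z \<in> topspace (prod_topology T T). fst z \<otimes> snd z = snd z \<otimes> fst z} \<in> sets P"
    by (rule square.closedin_sets)
  also have "{z \<in> topspace (prod_topology T T). fst z \<otimes> snd z = snd z \<otimes> fst z} = commuting_pairs"
    by (auto simp: commuting_pairs_def topspace_eq_carrier)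
  finally show ?thesis .
qed

lemma openin_times_sets:
  assumes "openin T A" "openin T B" shows "A \<times> B \<in> sets P"
  using assms by (intro square.openin_sets) (simp add: openin_prod_Times_iff)

lemma closedin_times_sets:
  assumes "closedin T A" "closedin T B" shows "A \<times> B \<in> sets P"
  using assms by (intro square.closedin_sets) (simp add: closedin_prod_Times_iff)

lemma openin_carrier: "openin T (carrier G)"
  by (metis openin_topspace topspace_eq_carrier)

lemma closedin_carrier: "closedin T (carrier G)"
  by (metis closedin_topspace topspace_eq_carrier)

lemma measure_l_coset_times:
  assumes "A \<times> B \<in> sets P" "a \<in> carrier G" "b \<in> carrier G"
  shows "measure P ((a <# A) \<times> (b <# B)) = measure P (A \<times> B)"
  using square.measure_l_coset [of "A \<times> B" "(a, b)"] assms by (simp add: l_coset_DirProd)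

section \<open>Commuting pairs outside the levels of the FC-center\<close>

text \<open>If \<open>w\<close> and \<open>y\<close> are fixed, the \<open>c\<close> with \<open>(w, y c)\<close> commuting satisfy \<open>y\<^sup>-\<^sup>1 w y = c w c\<^sup>-\<^sup>1\<close>.
  So the translates of the set of commuting pairs by \<open>(\<one>, y\<^sup>-\<^sup>1)\<close>, \<open>y \<in> Y\<close>, are disjoint above \<open>w\<close>. This replaces
  Fubini's theorem, which would need the product sigma-algebra.\<close>

lemma measure_commuting_pairs_le:
  assumes Y: "Y \<subseteq> carrier G" "finite Y"
    and inj: "\<And>w. w \<in> B \<Longrightarrow> inj_on (\<lambda>y. inv y \<otimes> w \<otimes> y) Y"
    and B: "B \<subseteq> carrier G" "B \<times> carrier G \<in> sets P"
  shows "card Y * measure P (commuting_pairs \<inter> B \<times> carrier G) \<le> measure P (B \<times> carrier G)"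
proof -
  let ?D = "commuting_pairs \<inter> B \<times> carrier G"
  define R where "R = (\<lambda>y. (\<one>, inv y)) ` Y"
  have RG: "R \<subseteq> carrier (G \<times>\<times> G)" "finite R"
    using Y by (auto simp: R_def)
  have "inj_on (\<lambda>y. (\<one>, inv y)) Y"
    using inj_on_subset [OF inv_inj Y(1)] by (auto simp: inj_on_def)
  then have cardR: "card R = card Y"
    by (simp add: R_def card_image)
  have D: "?D \<in> sets P" "?D \<subseteq> carrier (G \<times>\<times> G)"
    using B sets_commuting_pairs by auto
  have mem: "w \<in> B \<and> c \<in> carrier G \<and> inv y \<otimes> w \<otimes> y = c \<otimes> w \<otimes> inv c"
    if wc: "(w, c) \<in> (\<one>, inv y) <#\<^bsub>G \<times>\<times> G\<^esub> ?D" and y: "y \<in> Y" for w c y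
  proof -
    have yG: "y \<in> carrier G" using y Y by auto
    have "(w, c) \<in> carrier (G \<times>\<times> G)" "inv\<^bsub>G \<times>\<times> G\<^esub> (\<one>, inv y) \<otimes>\<^bsub>G \<times>\<times> G\<^esub> (w, c) \<in> ?D"
      using wc yG square.mem_l_coset_iff [OF D(2), of "(\<one>, inv y)" "(w, c)"] by auto
    then have w: "w \<in> B" "w \<in> carrier G" and c: "c \<in> carrier G"
      and comm: "w \<otimes> (y \<otimes> c) = (y \<otimes> c) \<otimes> w"
      using yG by (auto simp: commuting_pairs_def is_group)
    have "inv y \<otimes> (w \<otimes> (y \<otimes> c)) = c \<otimes> w"
      using w c yG comm by (simp add: inv_solve_left' m_assoc)
    then have "c \<otimes> w = (inv y \<otimes> w \<otimes> y) \<otimes> c"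
      using w c yG by (simp add: m_assoc)
    then show ?thesis
      using w c yG by (subst inv_solve_right) auto
  qed
  have "disjoint_family_on (\<lambda>r. r <#\<^bsub>G \<times>\<times> G\<^esub> ?D) R"
    unfolding disjoint_family_on_def
  proof (intro ballI impI)
    fix r s assume rs: "r \<in> R" "s \<in> R" "r \<noteq> s"
    then obtain y z where yz: "r = (\<one>, inv y)" "s = (\<one>, inv z)" "y \<in> Y" "z \<in> Y" "y \<noteq> z"
      by (auto simp: R_def)
    have False if "x \<in> r <#\<^bsub>G \<times>\<times> G\<^esub> ?D" "x \<in> s <#\<^bsub>G \<times>\<times> G\<^esub> ?D" for x
    proof -
      obtain w c where x: "x = (w, c)" by fastforce
      have "w \<in> B" "inv y \<otimes> w \<otimes> y = inv z \<otimes> w \<otimes> z"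
        using mem [of w c y] mem [of w c z] that yz x by auto
      then show False
        using inj [of w] yz by (auto simp: inj_on_def)
    qed
    then show "(r <#\<^bsub>G \<times>\<times> G\<^esub> ?D) \<inter> (s <#\<^bsub>G \<times>\<times> G\<^esub> ?D) = {}" by blast
  qed
  then have "card Y * measure P ?D = measure P (\<Union>r\<in>R. r <#\<^bsub>G \<times>\<times> G\<^esub> ?D)"
    using square.measure_disjoint_translates [OF D(1) RG(2,1)] cardR by simp
  also have "\<dots> \<le> measure P (B \<times> carrier G)"
    using mem B by (intro square.finite_measure_mono) (auto simp: R_def)
  finally show ?thesis .
qed

text \<open>Different \<open>W\<close> come with different sets \<open>Y\<close>. Cutting
  \<open>A\<close> into the disjoint parts \<open>A \<inter> W\<close> and \<open>A - W\<close>
  makes the estimates add up without loss from overlaps.\<close>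

lemma measure_commuting_pairs_Union_le:
  assumes "finite \<W>"
    and W: "\<And>W. W \<in> \<W> \<Longrightarrow> openin T W \<and> (\<exists>Y \<subseteq> carrier G. finite Y \<and> card Y = n \<and>
      (\<forall>w\<in>W. inj_on (\<lambda>y. inv y \<otimes> w \<otimes> y) Y))"
    and "A \<subseteq> \<Union>\<W>" "A \<times> carrier G \<in> sets P"
  shows "n * measure P (commuting_pairs \<inter> A \<times> carrier G) \<le> measure P (A \<times> carrier G)"
  using assms
proof (induction \<W> arbitrary: A)
  case empty
  then show ?case by simp
next
  case (insert W \<W>)
  have W: "openin T W" "W \<subseteq> carrier G"
    using insert.prems(1) [of W] openin_subset [of T W] by (auto simp: topspace_eq_carrier)
  obtain Y where Y: "Y \<subseteq> carrier G" "finite Y" "card Y = n"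
    "\<And>w. w \<in> W \<Longrightarrow> inj_on (\<lambda>y. inv y \<otimes> w \<otimes> y) Y"
    using insert.prems(1) [of W] by auto
  have eq: "A \<times> carrier G \<inter> W \<times> carrier G = (A \<inter> W) \<times> carrier G"
    "A \<times> carrier G - W \<times> carrier G = (A - W) \<times> carrier G" by auto
  have sets: "(A \<inter> W) \<times> carrier G \<in> sets P" "(A - W) \<times> carrier G \<in> sets P"
    using insert.prems(3) openin_times_sets [OF W(1) openin_carrier]
    by (auto simp flip: eq)
  have split: "X \<inter> A \<times> carrier G = (X \<inter> (A \<inter> W) \<times> carrier G) \<union> (X \<inter> (A - W) \<times> carrier G)" for X
    by auto
  have "n * measure P (commuting_pairs \<inter> (A \<inter> W) \<times> carrier G) \<le> measure P ((A \<inter> W) \<times> carrier G)"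
    using measure_commuting_pairs_le [of Y "A \<inter> W"] Y W sets by auto
  moreover have "n * measure P (commuting_pairs \<inter> (A - W) \<times> carrier G) \<le> measure P ((A - W) \<times> carrier G)"
    using insert.prems sets by (intro insert.IH) auto
  moreover have "measure P (commuting_pairs \<inter> A \<times> carrier G) =
      measure P (commuting_pairs \<inter> (A \<inter> W) \<times> carrier G) +
      measure P (commuting_pairs \<inter> (A - W) \<times> carrier G)"
    by (subst split, rule square.finite_measure_Union) (use sets in auto)
  moreover have "measure P (A \<times> carrier G) =
      measure P ((A \<inter> W) \<times> carrier G) + measure P ((A - W) \<times> carrier G)"
    using split [of UNIV] square.finite_measure_Union [OF sets] by auto
  ultimately show ?case
    by (simp add: distrib_left)
qed

text \<open>The complement of the level is covered by neighbourhoods with \<open>n + 1\<close>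
  distinct conjugates, but perhaps not by finitely many. Inner regularity supplies a compact set
  that is, and the part left over is smaller than any supposed excess.\<close>

lemma measure_commuting_pairs_outside_FC_level:
  "measure P (commuting_pairs \<inter> (carrier G - FC_level G n) \<times> carrier G) \<le> 1 / Suc n"
proof (rule ccontr)
  define U where "U = (carrier G - FC_level G n) \<times> carrier G"
  have oU: "openin (prod_topology T T) U"
    unfolding U_def using closedin_FC_level
    by (auto simp: openin_prod_Times_iff openin_carrier)
  then have sU: "U \<in> sets P"
    by (rule square.openin_sets)
  assume "\<not> measure P (commuting_pairs \<inter> (carrier G - FC_level G n) \<times> carrier G) \<le> 1 / Suc n"
  then have gt: "measure P (commuting_pairs \<inter> U) > 1 / Suc n"
    by (simp add: U_def)
  define e where "e = measure P (commuting_pairs \<inter> U) - 1 / Suc n"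
  have "e > 0" using gt by (simp add: e_def)
  have "measure P (commuting_pairs \<inter> U) \<le> measure P U"
    using sU by (intro square.finite_measure_mono) auto
  \<comment> \<open>Makes the threshold \<open>measure P U - e\<close> nonnegative, so that it
    passes through \<open>ennreal\<close> unchanged.\<close>
  then have "e \<le> measure P U"
    by (simp add: e_def add_increasing2 diff_le_eq)
  then obtain K where K: "compactin (prod_topology T T) K" "K \<subseteq> U"
      "ennreal (measure P U - e) < emeasure P K"
    using square.inner_regular [OF oU, of "measure P U - e"] \<open>e > 0\<close> by auto
  have sK: "K \<in> sets P"
    using K(1) hausdorff
    by (intro square.closedin_sets compactin_imp_closedin) (simp_all add: Hausdorff_space_prod_topology)
  have mK: "measure P U - e < measure P K"
    using K(3) \<open>e \<le> measure P U\<close> by (simp add: square.emeasure_eq_measure ennreal_less_iff)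
  define good where "good W \<longleftrightarrow> openin T W \<and> (\<exists>Y \<subseteq> carrier G. finite Y \<and> card Y = Suc n \<and>
      (\<forall>w\<in>W. inj_on (\<lambda>y. inv y \<otimes> w \<otimes> y) Y))" for W
  \<comment> \<open>The good neighbourhoods constrain only the first coordinate, so covering the
    projection of \<open>K\<close> suffices.\<close>
  have "\<exists>\<W>. finite \<W> \<and> \<W> \<subseteq> Collect good \<and> fst ` K \<subseteq> \<Union>\<W>"
  proof (rule compactinD)
    show "compactin T (fst ` K)"
      using K(1) by (rule image_compactin) (rule continuous_map_fst)
    show "openin T W" if "W \<in> Collect good" for W
      using that by (simp add: good_def)
    show "fst ` K \<subseteq> \<Union>(Collect good)"
    proof
      fix x assume "x \<in> fst ` K"
      then have "x \<in> carrier G" "x \<notin> FC_level G n"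
        using K(2) by (auto simp: U_def)
      then obtain W Y where "openin T W" "x \<in> W" "Y \<subseteq> carrier G" "finite Y" "card Y = Suc n"
        "\<And>w. w \<in> W \<Longrightarrow> inj_on (\<lambda>y. inv y \<otimes> w \<otimes> y) Y"
        by (rule FC_level_complement_nbhd) blast
      then show "x \<in> \<Union>(Collect good)"
        by (auto simp: good_def)
    qed
  qed
  then obtain \<W> where \<W>: "finite \<W>" "\<W> \<subseteq> Collect good" "fst ` K \<subseteq> \<Union>\<W>" by blast
  have "openin T (\<Union>\<W>)"
    using \<W> by (intro openin_Union) (auto simp: good_def)
  then have sO: "(\<Union>\<W>) \<times> carrier G \<in> sets P"
    using openin_carrier by (rule openin_times_sets)
  have "Suc n * measure P (commuting_pairs \<inter> (\<Union>\<W>) \<times> carrier G) \<le> measure P ((\<Union>\<W>) \<times> carrier G)"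
    by (rule measure_commuting_pairs_Union_le [OF \<W>(1) _ subset_refl sO])
      (use \<W>(2) in \<open>auto simp: good_def\<close>)
  also have "\<dots> \<le> measure P (carrier (G \<times>\<times> G))"
    unfolding square.space_haar [symmetric] by (rule square.bounded_measure)
  finally have le: "measure P (commuting_pairs \<inter> (\<Union>\<W>) \<times> carrier G) \<le> 1 / Suc n"
    unfolding square.measure_carrier by (simp add: field_simps)
  \<comment> \<open>The first part has measure at most \<open>1 / Suc n\<close> and the second less
    than \<open>e\<close>, which contradicts the choice of \<open>e\<close>.\<close>
  have "commuting_pairs \<inter> U \<subseteq> (commuting_pairs \<inter> (\<Union>\<W>) \<times> carrier G) \<union> (U - K)"
  proof
    fix z assume z: "z \<in> commuting_pairs \<inter> U"
    then have "z \<in> (\<Union>\<W>) \<times> carrier G" if "z \<in> K"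
      using \<W>(3) that by (auto simp: U_def mem_Times_iff)
    with z show "z \<in> (commuting_pairs \<inter> (\<Union>\<W>) \<times> carrier G) \<union> (U - K)"
      by blast
  qed
  then have "measure P (commuting_pairs \<inter> U)
      \<le> measure P ((commuting_pairs \<inter> (\<Union>\<W>) \<times> carrier G) \<union> (U - K))"
    using sO sU sK by (intro square.finite_measure_mono) auto
  also have "\<dots> \<le> measure P (commuting_pairs \<inter> (\<Union>\<W>) \<times> carrier G) + measure P (U - K)"
    using sO sU sK by (intro measure_Un_le) auto
  also have "measure P (U - K) = measure P U - measure P K"
    using K(2) sK sU by (intro square.finite_measure_Diff) auto
  finally show False
    using le mK by (simp add: e_def)
qed

text \<open>The FC-center contains every level, so the preceding bound applies for all
  \<open>n\<close> at once.\<close>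

lemma measure_commuting_pairs_outside_FC_center:
  assumes "openin T (FC_center G)"
  shows "measure P (commuting_pairs \<inter> (carrier G - FC_center G) \<times> carrier G) = 0"
    (is "?m = 0")
proof (rule ccontr)
  assume "?m \<noteq> 0"
  then have "?m > 0" using measure_nonneg [of P] by (simp add: less_le)
  then obtain n where n: "1 / Suc n < ?m"
    using nat_approx_posE by blast
  have "?m \<le> measure P (commuting_pairs \<inter> (carrier G - FC_level G n) \<times> carrier G)"
    using FC_level_subset_FC_center [of G n]
    by (intro square.finite_measure_mono sets.Int sets_commuting_pairs openin_times_sets
        openin_carrier openin_diff closedin_FC_level) auto
  with n measure_commuting_pairs_outside_FC_level [of n] show False by simp
qed

section \<open>Positive commutativity degree and openness of the center of the FC-center\<close>

text \<open>Steinhaus' argument: an open set containing \<open>A \<times> G\<close> contains \<open>vA \<times> G\<close> for all \<open>v\<close> near \<open>\<one>\<close>. If its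
  measure is less than twice that of \<open>A \<times> G\<close>, then \<open>vA\<close> meets \<open>A\<close>.\<close>

lemma difference_set_nbhd_one:
  assumes A: "closedin T A" and pos: "measure P (A \<times> carrier G) > 0"
  obtains V where "openin T V" "\<one> \<in> V" "V \<subseteq> (\<lambda>(a, b). a \<otimes> inv b) ` (A \<times> A)"
proof -
  have AG: "A \<subseteq> carrier G"
    using closedin_subset [OF A] by (simp add: topspace_eq_carrier)
  let ?A = "A \<times> carrier G"
  have sA: "?A \<in> sets P"
    by (intro closedin_times_sets A closedin_carrier)
  obtain U where U: "openin (prod_topology T T) U" "?A \<subseteq> U" "measure P U < 2 * measure P ?A"
    using square.outer_regular [OF sA, of "2 * measure P ?A"] pos by auto
  \<comment> \<open>The triples \<open>(v, (a, y))\<close> for which translating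
    \<open>(a, y)\<close> by \<open>(v, \<one>)\<close> lands in \<open>U\<close>. The tube lemma
    around \<open>\<one>\<close> makes this uniform over the compact box.\<close>
  define W where "W = {z \<in> topspace (prod_topology T (prod_topology T T)).
    (fst z \<otimes> fst (snd z), snd (snd z)) \<in> U}"
  have "openin (prod_topology T (prod_topology T T)) W"
    unfolding W_def
  proof (rule openin_continuous_map_preimage [OF _ U(1)])
    have "continuous_map (prod_topology T (prod_topology T T)) T (\<lambda>z. fst (snd z))"
      "continuous_map (prod_topology T (prod_topology T T)) T (\<lambda>z. snd (snd z))"
      using continuous_map_compose [OF continuous_map_snd continuous_map_fst, of T T T]
        continuous_map_compose [OF continuous_map_snd continuous_map_snd, of T T T]
      by (simp_all add: o_def)
    then show "continuous_map (prod_topology T (prod_topology T T)) (prod_topology T T)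
        (\<lambda>z. (fst z \<otimes> fst (snd z), snd (snd z)))"
      by (intro continuous_map_pairedI continuous_map_mult continuous_map_fst)
  qed
  moreover have "compactin (prod_topology T T) ?A"
    using compact
    by (intro closedin_compact_space)
      (auto simp: closedin_prod_Times_iff A closedin_carrier compact_space_prod_topology)
  moreover have "{\<one>} \<times> ?A \<subseteq> W"
    using AG U(2) by (auto simp: W_def topspace_eq_carrier subset_iff)
  ultimately obtain V X where V: "openin T V" "\<one> \<in> V" "?A \<subseteq> X" "V \<times> X \<subseteq> W"
    using tube_lemma_right [of T "prod_topology T T" W ?A \<one>] by (auto simp: topspace_eq_carrier)
  have "v \<in> (\<lambda>(a, b). a \<otimes> inv b) ` (A \<times> A)" if v: "v \<in> V" for v
  proof (rule ccontr)
    assume notin: "v \<notin> (\<lambda>(a, b). a \<otimes> inv b) ` (A \<times> A)"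
    have vG: "v \<in> carrier G"
      using v openin_subset [OF V(1)] by (auto simp: topspace_eq_carrier)
    have vA: "(v, \<one>) <#\<^bsub>G \<times>\<times> G\<^esub> ?A \<in> sets P"
      using sA vG by (intro square.l_coset_sets) auto
    have False if a: "a \<in> A" "v \<otimes> a \<in> A" for a
    proof -
      have "v = (v \<otimes> a) \<otimes> inv a"
        using a AG vG by (auto simp: m_assoc)
      with a notin show False by force
    qed
    then have disj: "((v, \<one>) <#\<^bsub>G \<times>\<times> G\<^esub> ?A) \<inter> ?A = {}"
      by (auto simp: l_coset_DirProd) (auto simp: l_coset_def)
    have "(v \<otimes> a, y) \<in> U" if "a \<in> A" "y \<in> carrier G" for a y
    proof -
      have "(v, (a, y)) \<in> W"
        using V v that by blast
      then show ?thesis by (simp add: W_def)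
    qed
    then have sub: "((v, \<one>) <#\<^bsub>G \<times>\<times> G\<^esub> ?A) \<union> ?A \<subseteq> U"
      using U(2) by (auto simp: l_coset_DirProd) (auto simp: l_coset_def)
    have "2 * measure P ?A = measure P ((v, \<one>) <#\<^bsub>G \<times>\<times> G\<^esub> ?A) + measure P ?A"
      using square.measure_l_coset [OF sA] vG by simp
    also have "\<dots> = measure P (((v, \<one>) <#\<^bsub>G \<times>\<times> G\<^esub> ?A) \<union> ?A)"
      by (rule square.finite_measure_Union [OF vA sA disj, symmetric])
    also have "\<dots> \<le> measure P U"
      using U(1) sub by (intro square.finite_measure_mono) auto
    finally show False using U(3) by simp
  qed
  with V(1,2) that show thesis by blast
qed

lemma openin_center_FC_center_of_pos:
  assumes "measure P commuting_pairs > 0"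
  shows "openin T (centralizer G (FC_center G) (FC_center G))"
proof -
  \<comment> \<open>With this \<open>n\<close> the pairs outside \<open>FC_level G n\<close> cannot
    account for all commuting pairs, so the level itself has positive measure.\<close>
  obtain n where n: "1 / Suc n < measure P commuting_pairs"
    using nat_approx_posE [OF assms] by blast
  let ?A = "FC_level G n"
  have sets: "(carrier G - ?A) \<times> carrier G \<in> sets P" "?A \<times> carrier G \<in> sets P"
    by (intro openin_times_sets openin_diff openin_carrier closedin_FC_level
        closedin_times_sets closedin_carrier)+
  have "commuting_pairs \<subseteq> (commuting_pairs \<inter> (carrier G - ?A) \<times> carrier G) \<union> ?A \<times> carrier G"
    by (auto simp: commuting_pairs_def)
  then have "measure P commuting_pairs
      \<le> measure P ((commuting_pairs \<inter> (carrier G - ?A) \<times> carrier G) \<union> ?A \<times> carrier G)"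
    using sets by (intro square.finite_measure_mono) auto
  also have "\<dots> \<le> measure P (commuting_pairs \<inter> (carrier G - ?A) \<times> carrier G)
      + measure P (?A \<times> carrier G)"
    using sets by (intro measure_Un_le) auto
  finally have "measure P (?A \<times> carrier G) > 0"
    using measure_commuting_pairs_outside_FC_level [of n] n by simp
  then obtain V where V: "openin T V" "\<one> \<in> V" "V \<subseteq> (\<lambda>(a, b). a \<otimes> inv b) ` (?A \<times> ?A)"
    using difference_set_nbhd_one [OF closedin_FC_level] by blast
  have "V \<subseteq> FC_level G (n * n)"
    using V(3) FC_level_mult [OF _ FC_level_inv] by fastforce
  with V show ?thesis
    by (intro openin_center_FC_center)
qed

lemma measure_commuting_pairs_pos:
  assumes "openin T (centralizer G (FC_center G) (FC_center G))" (is "openin T ?Z")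
  shows "measure P commuting_pairs > 0"
proof -
  have "\<one> \<in> ?Z"
    using subgroup_FC_center FC_center_subset
    by (intro subgroup.one_closed subgroup_centralizer)
  then have "measure P (?Z \<times> ?Z) > 0"
    using assms compact
    by (intro square.measure_open_pos)
      (auto simp: compact_space_prod_topology openin_prod_Times_iff)
  also have "measure P (?Z \<times> ?Z) \<le> measure P commuting_pairs"
    using FC_center_subset [of G]
    by (intro square.finite_measure_mono sets_commuting_pairs)
      (auto simp: centralizer_def commuting_pairs_def)
  finally show ?thesis .
qed

section \<open>Measures of boxes in terms of subgroup indices\<close>

text \<open>Translates of \<open>B \<times> C\<close> by \<open>(r, \<one>)\<close>, with
  \<open>r\<close> in a left transversal, tile \<open>A \<times> C\<close>. Only invariance is used,
  not a product formula for \<open>P\<close>.\<close>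

lemma measure_index_times_left:
  assumes A: "subgroup A G" and B: "subgroup B G" "B \<subseteq> A" and sets: "B \<times> C \<in> sets P"
    and C: "C \<subseteq> carrier G" and fin: "finite_index G A B"
  shows "measure P (A \<times> C) = subgroup_index G A B * measure P (B \<times> C)"
proof -
  obtain R where R: "R \<subseteq> A" "finite R" "card R = subgroup_index G A B"
    "disjoint_family_on (\<lambda>r. r <# B) R" "(\<Union>r\<in>R. r <# B) = A"
    using left_transversal [OF A B] fin by metis
  have RG: "R \<subseteq> carrier G" using R A subgroup.subset by blast
  have one: "\<one> <# C = C"
    using C by (force simp: l_coset_def)
  define S where "S = (\<lambda>r. (r, \<one>)) ` R"
  have "measure P (\<Union>s\<in>S. s <#\<^bsub>G \<times>\<times> G\<^esub> (B \<times> C)) = card S * measure P (B \<times> C)"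
  proof (rule square.measure_disjoint_translates [OF sets])
    show "finite S" "S \<subseteq> carrier (G \<times>\<times> G)"
      using R RG by (auto simp: S_def)
    show "disjoint_family_on (\<lambda>s. s <#\<^bsub>G \<times>\<times> G\<^esub> (B \<times> C)) S"
      using R(4) by (auto simp: disjoint_family_on_def S_def l_coset_DirProd)
  qed
  also have "(\<Union>s\<in>S. s <#\<^bsub>G \<times>\<times> G\<^esub> (B \<times> C)) = A \<times> C"
    unfolding R(5) [symmetric] by (auto simp: S_def l_coset_DirProd one)
  also have "card S = subgroup_index G A B"
    unfolding S_def R(3) [symmetric] by (intro card_image inj_onI) auto
  finally show ?thesis .
qed

lemma measure_index_times_right:
  assumes A: "subgroup A G" and B: "subgroup B G" "B \<subseteq> A" and sets: "C \<times> B \<in> sets P"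
    and C: "C \<subseteq> carrier G" and fin: "finite_index G A B"
  shows "measure P (C \<times> A) = subgroup_index G A B * measure P (C \<times> B)"
proof -
  obtain R where R: "R \<subseteq> A" "finite R" "card R = subgroup_index G A B"
    "disjoint_family_on (\<lambda>r. r <# B) R" "(\<Union>r\<in>R. r <# B) = A"
    using left_transversal [OF A B] fin by metis
  have RG: "R \<subseteq> carrier G" using R A subgroup.subset by blast
  have one: "\<one> <# C = C"
    using C by (force simp: l_coset_def)
  define S where "S = (\<lambda>r. (\<one>, r)) ` R"
  have "measure P (\<Union>s\<in>S. s <#\<^bsub>G \<times>\<times> G\<^esub> (C \<times> B)) = card S * measure P (C \<times> B)"
  proof (rule square.measure_disjoint_translates [OF sets])
    show "finite S" "S \<subseteq> carrier (G \<times>\<times> G)"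
      using R RG by (auto simp: S_def)
    show "disjoint_family_on (\<lambda>s. s <#\<^bsub>G \<times>\<times> G\<^esub> (C \<times> B)) S"
      using R(4) by (auto simp: disjoint_family_on_def S_def l_coset_DirProd)
  qed
  also have "(\<Union>s\<in>S. s <#\<^bsub>G \<times>\<times> G\<^esub> (C \<times> B)) = C \<times> A"
    unfolding R(5) [symmetric] by (auto simp: S_def l_coset_DirProd one)
  also have "card S = subgroup_index G A B"
    unfolding S_def R(3) [symmetric] by (intro card_image inj_onI) auto
  finally show ?thesis .
qed

text \<open>There are arbitrarily many disjoint translates of equal measure in a space of total
  measure 1.\<close>

lemma measure_infinite_index_times:
  assumes A: "subgroup A G" and B: "subgroup B G" "B \<subseteq> A" and sets: "B \<times> C \<in> sets P"
    and inf: "\<not> finite_index G A B"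
  shows "measure P (B \<times> C) = 0"
proof -
  obtain R where R: "R \<subseteq> A" "infinite R" "disjoint_family_on (\<lambda>r. r <# B) R"
    using left_transversal [OF A B] inf by metis
  have "real n * measure P (B \<times> C) \<le> 1" for n
  proof -
    obtain Q where Q: "Q \<subseteq> R" "finite Q" "card Q = n"
      using infinite_arbitrarily_large [OF R(2)] by blast
    have QG: "Q \<subseteq> carrier G" using Q R A subgroup.subset by blast
    define S where "S = (\<lambda>r. (r, \<one>)) ` Q"
    have "measure P (\<Union>s\<in>S. s <#\<^bsub>G \<times>\<times> G\<^esub> (B \<times> C)) = card S * measure P (B \<times> C)"
    proof (rule square.measure_disjoint_translates [OF sets])
      show "finite S" "S \<subseteq> carrier (G \<times>\<times> G)"
        using Q QG by (auto simp: S_def)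
      show "disjoint_family_on (\<lambda>s. s <#\<^bsub>G \<times>\<times> G\<^esub> (B \<times> C)) S"
        using R(3) Q(1) by (auto simp: disjoint_family_on_def S_def l_coset_DirProd)
    qed
    moreover have "card S = n"
      unfolding S_def Q(3) [symmetric] by (intro card_image inj_onI) auto
    moreover have "measure P (\<Union>s\<in>S. s <#\<^bsub>G \<times>\<times> G\<^esub> (B \<times> C)) \<le> 1"
      using square.bounded_measure square.measure_carrier unfolding square.space_haar by metis
    ultimately show ?thesis by simp
  qed
  then show ?thesis
    by (metis measure_nonneg less_eq_real_def ex_less_of_nat_mult linorder_not_less)
qed

section \<open>The formula for the commutativity degree\<close>

text \<open>Elements of \<open>Z\<close> commute with all of \<open>F\<close>, so whether
  \<open>x \<in> F\<close> commutes with \<open>r \<otimes> z\<close> depends on \<open>r\<close>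
  alone. The commuting pairs over one coset therefore form a box.\<close>

lemma commuting_pairs_l_coset:
  fixes F Z :: "'a set"
  assumes F: "F \<subseteq> carrier G" and r: "r \<in> carrier G"
  defines "Z \<equiv> centralizer G F (carrier G)"
  shows "commuting_pairs \<inter> F \<times> (r <# Z) = centralizer G {r} F \<times> (r <# Z)"
proof -
  have *: "x \<otimes> (r \<otimes> z) = (r \<otimes> z) \<otimes> x \<longleftrightarrow> x \<otimes> r = r \<otimes> x"
    if x: "x \<in> F" and z: "z \<in> Z" for x z
  proof -
    have xz: "x \<in> carrier G" "z \<in> carrier G" "z \<otimes> x = x \<otimes> z"
      using x z F by (auto simp: Z_def centralizer_def)
    have "x \<otimes> (r \<otimes> z) = (x \<otimes> r) \<otimes> z" "(r \<otimes> z) \<otimes> x = (r \<otimes> x) \<otimes> z"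
      using xz r by (simp_all add: m_assoc)
    then show ?thesis
      using xz r by simp
  qed
  have "Z \<subseteq> carrier G" by (auto simp: Z_def centralizer_def)
  then show ?thesis
    using F r * by (auto simp: commuting_pairs_def centralizer_def l_coset_def)
qed

lemma commutativity_degree_formula:
  fixes F Z :: "'a set"
  defines "F \<equiv> FC_center G" and "Z \<equiv> centralizer G F (carrier G)"
  assumes op: "openin T (centralizer G F F)"
  obtains R where "finite_index G (carrier G) F" "finite_index G (carrier G) Z"
    "R \<subseteq> carrier G" "finite R" "card R \<le> subgroup_index G (carrier G) Z"
    "\<And>r. r \<in> R \<Longrightarrow> finite_index G F (centralizer G {r} F)"
    "commutativity_degree G P =
      1 / (real (subgroup_index G (carrier G) F) * real (subgroup_index G (carrier G) Z)) *
      (\<Sum>r\<in>R. inverse (real (subgroup_index G F (centralizer G {r} F))))"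
proof -
  let ?C = "\<lambda>r. centralizer G {r} F"
  have F: "subgroup F G" and FG: "F \<subseteq> carrier G"
    unfolding F_def by (rule subgroup_FC_center, rule FC_center_subset)
  have Z: "subgroup Z G" and ZG: "Z \<subseteq> carrier G"
    unfolding Z_def by (rule subgroup_centralizer [OF FG subgroup_self]) (auto simp: centralizer_def)
  have one: "\<one> \<in> centralizer G F F"
    by (rule subgroup.one_closed [OF subgroup_centralizer [OF FG F]])
  have oF: "openin T F"
    by (rule openin_subgroup [OF F op one]) (auto simp: centralizer_def)
  have oZ: "openin T Z"
    by (rule openin_subgroup [OF Z op one]) (use FG in \<open>auto simp: centralizer_def Z_def\<close>)
  have finF: "finite_index G (carrier G) F" and finZ: "finite_index G (carrier G) Z"
    by (rule finite_index_open_subgroup [OF F oF], rule finite_index_open_subgroup [OF Z oZ])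
  have clF: "closedin T F" and clZ: "closedin T Z"
    by (rule closedin_open_subgroup [OF F oF], rule closedin_open_subgroup [OF Z oZ])
  have C: "subgroup (?C r) G" "?C r \<subseteq> F" "closedin T (?C r)" if "r \<in> carrier G" for r
  proof -
    show "subgroup (?C r) G"
      using that F by (intro subgroup_centralizer) auto
    show "?C r \<subseteq> F" by (auto simp: centralizer_def)
    have "?C r = centralizer G {r} (carrier G) \<inter> F"
      using FG by (auto simp: centralizer_def)
    then show "closedin T (?C r)"
      using closedin_centralizer [OF that] clF by auto
  qed
  define f z where "f = real (subgroup_index G (carrier G) F)"
    and "z = real (subgroup_index G (carrier G) Z)"
  \<comment> \<open>Translates of \<open>F \<times> Z\<close> tile the square, \<open>f * z\<close>
    of them, which determines the measure of this box. That the total is 1 also shows both indices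
    to be nonzero.\<close>
  have "measure P (carrier G \<times> carrier G) = f * measure P (F \<times> carrier G)"
    unfolding f_def
    by (rule measure_index_times_left [OF subgroup_self F FG openin_times_sets [OF oF openin_carrier] _ finF]) simp
  also have "measure P (F \<times> carrier G) = z * measure P (F \<times> Z)"
    unfolding z_def
    by (rule measure_index_times_right [OF subgroup_self Z ZG openin_times_sets [OF oF oZ] FG finZ])
  finally have fz: "f * (z * measure P (F \<times> Z)) = 1"
    using square.measure_carrier by simp
  then have "f \<noteq> 0" "z \<noteq> 0"
    by auto
  with fz have FZ: "measure P (F \<times> Z) = 1 / (f * z)"
    by (simp add: eq_divide_eq mult_ac)
  obtain R where R: "R \<subseteq> carrier G" "finite R" "card R = subgroup_index G (carrier G) Z"
    "disjoint_family_on (\<lambda>r. r <# Z) R" "(\<Union>r\<in>R. r <# Z) = carrier G"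
    using left_transversal [OF subgroup_self Z ZG] finZ by metis
  \<comment> \<open>The cosets that contribute. Omitting the others is why only an inequality for
    \<open>n\<close> is claimed.\<close>
  define S where "S = {r \<in> R. finite_index G F (?C r)}"
  have sets: "F \<times> carrier G \<in> sets P" "(carrier G - F) \<times> carrier G \<in> sets P"
    by (intro openin_times_sets oF openin_carrier openin_diff clF)+
  \<comment> \<open>Translation by \<open>(\<one>, r)\<close> reduces to
    \<open>?C r \<times> Z\<close>. If the index of \<open>?C r\<close> in \<open>F\<close> is
    finite, that many translates tile \<open>F \<times> Z\<close>; otherwise the box is
    null.\<close>
  have piece: "measure P (?C r \<times> (r <# Z)) =
      (if r \<in> S then 1 / (f * z) * inverse (real (subgroup_index G F (?C r))) else 0)"
    if r: "r \<in> R" for r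
  proof -
    have rG: "r \<in> carrier G" using r R by auto
    have sC: "?C r \<times> Z \<in> sets P"
      by (intro closedin_times_sets C rG clZ)
    have "\<one> <# ?C r = ?C r"
      using C(2) [OF rG] FG by (force simp: l_coset_def)
    then have eq: "measure P (?C r \<times> (r <# Z)) = measure P (?C r \<times> Z)"
      using measure_l_coset_times [OF sC, of \<one> r] rG by simp
    show ?thesis
    proof (cases "r \<in> S")
      case True
      then have "measure P (F \<times> Z) = subgroup_index G F (?C r) * measure P (?C r \<times> Z)"
        by (intro measure_index_times_left F C rG sC ZG) (auto simp: S_def)
      moreover have "measure P (F \<times> Z) \<noteq> 0"
        using fz by auto
      ultimately show ?thesis
        using True unfolding eq FZ [symmetric] by (auto simp: field_simps)
    next
      case False
      then have "measure P (?C r \<times> Z) = 0"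
        using r by (intro measure_infinite_index_times [OF F C(1,2) sC] rG) (auto simp: S_def)
      with False eq show ?thesis by simp
    qed
  qed
  \<comment> \<open>The part outside \<open>F\<close> is null; the part above \<open>F\<close> is
    then split along the cosets \<open>r <# Z\<close> in the second coordinate.\<close>
  have "commuting_pairs = (commuting_pairs \<inter> F \<times> carrier G)
      \<union> (commuting_pairs \<inter> (carrier G - F) \<times> carrier G)"
    by (auto simp: commuting_pairs_def)
  then have "measure P commuting_pairs = measure P (commuting_pairs \<inter> F \<times> carrier G)
      + measure P (commuting_pairs \<inter> (carrier G - F) \<times> carrier G)"
    using square.finite_measure_Union [of "commuting_pairs \<inter> F \<times> carrier G"
        "commuting_pairs \<inter> (carrier G - F) \<times> carrier G"] sets by auto
  also have "measure P (commuting_pairs \<inter> (carrier G - F) \<times> carrier G) = 0"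
    using measure_commuting_pairs_outside_FC_center oF by (simp add: F_def)
  also have "commuting_pairs \<inter> F \<times> carrier G = (\<Union>r\<in>R. ?C r \<times> (r <# Z))"
  proof -
    have "commuting_pairs \<inter> F \<times> carrier G = (\<Union>r\<in>R. commuting_pairs \<inter> F \<times> (r <# Z))"
      unfolding R(5) [symmetric] by auto
    also have "\<dots> = (\<Union>r\<in>R. ?C r \<times> (r <# Z))"
      using commuting_pairs_l_coset [OF FG] R(1) unfolding Z_def by (intro SUP_cong) auto
    finally show ?thesis .
  qed
  also have "measure P (\<Union>r\<in>R. ?C r \<times> (r <# Z)) = (\<Sum>r\<in>R. measure P (?C r \<times> (r <# Z)))"
  proof (rule square.finite_measure_finite_Union [OF R(2)])
    show "(\<lambda>r. ?C r \<times> (r <# Z)) ` R \<subseteq> sets P"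
      using R(1) C(3) clZ by (auto intro!: closedin_times_sets closedin_l_coset)
    show "disjoint_family_on (\<lambda>r. ?C r \<times> (r <# Z)) R"
      using R(4) by (auto simp: disjoint_family_on_def)
  qed
  also have "\<dots> = (\<Sum>r\<in>R. if r \<in> S then 1 / (f * z) * inverse (real (subgroup_index G F (?C r))) else 0)"
    by (intro sum.cong piece) auto
  also have "\<dots> = (\<Sum>r\<in>S. 1 / (f * z) * inverse (real (subgroup_index G F (?C r))))"
    using R(2) by (intro sum.mono_neutral_cong_right) (auto simp: S_def)
  finally have deg: "commutativity_degree G P =
      1 / (f * z) * (\<Sum>r\<in>S. inverse (real (subgroup_index G F (?C r))))"
    by (simp add: commutativity_degree_eq sum_distrib_left)
  show thesis
  proof (rule that [OF finF finZ])
    show "S \<subseteq> carrier G" "finite S" "\<And>r. r \<in> S \<Longrightarrow> finite_index G F (?C r)"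
      using R by (auto simp: S_def)
    show "card S \<le> subgroup_index G (carrier G) Z"
      unfolding R(3) [symmetric] by (rule card_mono [OF R(2)]) (auto simp: S_def)
  qed (fact deg [unfolded f_def z_def])
qed

end

text \<open>The finiteness claims ensure that every \<open>subgroup_index\<close> in the formula is
  a true index rather than the default value 0 of \<open>card\<close>. Injectivity of
  \<open>g\<close> makes the listed elements distinct.\<close>

theorem theorem3p11:
  fixes G :: "('a, 'b) monoid_scheme" and T :: "'a topology"
    and P :: "('a \<times> 'a) measure" and F Z :: "'a set"
  assumes "compact_group G T"
    and "normalized_haar_measure (G \<times>\<times> G) (prod_topology T T) P"
  defines "F \<equiv> FC_center G"
    and "Z \<equiv> centralizer G F (carrier G)"
  shows
    "(commutativity_degree G P > 0 \<longleftrightarrow> openin T (centralizer G F F)) \<and>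
     (commutativity_degree G P > 0 \<longrightarrow>
        finite_index G (carrier G) F \<and> finite_index G (carrier G) Z \<and>
        (\<exists>n (g :: nat \<Rightarrow> 'a).
           n \<le> subgroup_index G (carrier G) Z \<and>
           g ` {1..n} \<subseteq> carrier G \<and> inj_on g {1..n} \<and>
           (\<forall>j\<in>{1..n}. finite_index G F (centralizer G {g j} F)) \<and>
           commutativity_degree G P =
             1 / (real (subgroup_index G (carrier G) F) * real (subgroup_index G (carrier G) Z)) *
             (\<Sum>j=1..n. inverse (real (subgroup_index G F (centralizer G {g j} F)))))) \<and>
     commutativity_degree G P \<in> \<rat>"
    (is "?i \<and> (?d > 0 \<longrightarrow> ?ii) \<and> _")
proof -
  interpret compact_group G T by fact
  interpret haar_square G T P
  proof (intro haar_square.intro haar_group.intro haar_group_axioms.intro)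
    show "topological_group (G \<times>\<times> G) (prod_topology T T)"
      by (intro topological_group_DirProd) unfold_locales
  qed (fact assms)+
  have i: ?i
    using openin_center_FC_center_of_pos measure_commuting_pairs_pos
    unfolding commutativity_degree_eq F_def by blast
  have ii: ?ii and rational: "?d \<in> \<rat>" if "?d > 0"
  proof -
    have "openin T (centralizer G F F)" using i that by simp
    then obtain R where R: "finite_index G (carrier G) F" "finite_index G (carrier G) Z"
      "R \<subseteq> carrier G" "finite R" "card R \<le> subgroup_index G (carrier G) Z"
      "\<And>r. r \<in> R \<Longrightarrow> finite_index G F (centralizer G {r} F)"
      and d: "?d = 1 / (real (subgroup_index G (carrier G) F) * real (subgroup_index G (carrier G) Z)) *
        (\<Sum>r\<in>R. inverse (real (subgroup_index G F (centralizer G {r} F))))"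
      unfolding F_def Z_def by (rule commutativity_degree_formula) blast
    obtain g where g: "bij_betw g {1..card R} R"
      using ex_bij_betw_nat_finite_1 [OF R(4)] by blast
    have "(\<Sum>r\<in>R. inverse (real (subgroup_index G F (centralizer G {r} F)))) =
        (\<Sum>j=1..card R. inverse (real (subgroup_index G F (centralizer G {g j} F))))"
      by (rule sum.reindex_bij_betw [OF g, symmetric])
    with d have "?d = 1 / (real (subgroup_index G (carrier G) F) * real (subgroup_index G (carrier G) Z)) *
        (\<Sum>j=1..card R. inverse (real (subgroup_index G F (centralizer G {g j} F))))"
      by simp
    moreover have "g ` {1..card R} = R" "inj_on g {1..card R}"
      using g by (auto simp: bij_betw_def)
    ultimately show ?ii
      using R(1-3,5,6) by (intro conjI exI [of _ "card R"] exI [of _ g]) auto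
    show "?d \<in> \<rat>"
      unfolding d by (intro Rats_mult Rats_divide Rats_sum Rats_inverse) auto
  qed
  \<comment> \<open>In the positive case the formula is a finite expression in natural numbers;
    otherwise nonnegativity of the measure leaves only the value 0.\<close>
  have "?d \<in> \<rat>"
  proof (cases "?d > 0")
    case False
    then have "?d = 0"
      using measure_nonneg [of P] unfolding commutativity_degree_def by (simp add: not_less antisym)
    then show ?thesis by simp
  qed (fact rational)
  with i ii show ?thesis by blast
qed

end
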